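(* Let $\phi$ be a real-valued, even Schwartz function on $\mathbb{R}$ and consider the regularized nonlinear Schrödinger equation $$i u_t+u_{xx}=\phi*\big(|\phi*u|^2(\phi*u)\big),\qquad u:\mathbb{R}\times\mathbb{R}\to\mathbb{C},\qquad u(0,x)=u_0(x).$$ If $u_0\in C^2(\mathbb{R})$ (with $u_0,u_0',u_0''$ bounded), then this equation has a local solution on $[0,T]$ for some $T=T(\phi,\|u_0\|_{L^\infty},\|\nabla^2u_0\|_{L^\infty})>0$. The solution $u$ is bounded and uniformly continuous on $[0,T]\times\mathbb{R}$.
   Context: $*$ denotes convolution on $\mathbb{R}$, $(f*g)(x)=\int f(y)g(x-y)\,dy$. A solution is understood in the Duhamel sense $u(t)=e^{it\partial_{xx}}u_0-i\int_0^t e^{i(t-\tau)\partial_{xx}}\big(\phi*(|\phi*u|^2(\phi*u))\big)(\tau)\,d\tau$. *)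

theory Defs
  imports "HOL-Analysis.Analysis"
begin

definition schwartz :: "(real \<Rightarrow> real) \<Rightarrow> bool" where
  "schwartz \<phi> \<longleftrightarrow>
     (\<forall>n x. ((deriv ^^ n) \<phi>) differentiable (at x)) \<and>
     (\<forall>n k. \<exists>C. \<forall>x. \<bar>x\<bar> ^ k * \<bar>(deriv ^^ n) \<phi> x\<bar> \<le> C)"

definition even_fun :: "(real \<Rightarrow> real) \<Rightarrow> bool" where
  "even_fun \<phi> \<longleftrightarrow> (\<forall>x. \<phi> (- x) = \<phi> x)"

definition conv :: "(real \<Rightarrow> complex) \<Rightarrow> (real \<Rightarrow> complex) \<Rightarrow> real \<Rightarrow> complex" where
  "conv f g x = (LINT y|lborel. f y * g (x - y))"

definition nonlin :: "(real \<Rightarrow> real) \<Rightarrow> (real \<Rightarrow> complex) \<Rightarrow> real \<Rightarrow> complex" where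
  "nonlin \<phi> v =
     (let \<phi>c = (\<lambda>y. complex_of_real (\<phi> y)); w = conv \<phi>c v
      in conv \<phi>c (\<lambda>x. complex_of_real ((cmod (w x))\<^sup>2) * w x))"

definition schr_trunc :: "real \<Rightarrow> (real \<Rightarrow> complex) \<Rightarrow> real \<Rightarrow> real \<Rightarrow> complex" where
  "schr_trunc t f x R =
     (LINT y:{-R..R}|lborel.
        exp (\<i> * complex_of_real ((x - y)\<^sup>2 / (4 * t))) * f y)
     / csqrt (4 * complex_of_real pi * \<i> * complex_of_real t)"

text \<open>The free Schroedinger group e^{it d_xx} (t \<ge> 0), applied to f and evaluated at x,
  as the oscillatory (improper, symmetric) kernel integral.\<close>
definition schr :: "real \<Rightarrow> (real \<Rightarrow> complex) \<Rightarrow> real \<Rightarrow> complex" where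
  "schr t f x = (if t = 0 then f x else Lim at_top (schr_trunc t f x))"

definition schr_converges :: "real \<Rightarrow> (real \<Rightarrow> complex) \<Rightarrow> real \<Rightarrow> bool" where
  "schr_converges t f x \<longleftrightarrow> t = 0 \<or> (\<exists>L. (schr_trunc t f x \<longlongrightarrow> L) at_top)"

definition C2_bdd :: "(real \<Rightarrow> complex) \<Rightarrow> (real \<Rightarrow> complex) \<Rightarrow> (real \<Rightarrow> complex) \<Rightarrow> bool" where
  "C2_bdd u0 u1 u2 \<longleftrightarrow>
     (\<forall>x. (u0 has_vector_derivative u1 x) (at x)) \<and>
     (\<forall>x. (u1 has_vector_derivative u2 x) (at x)) \<and>
     continuous_on UNIV u2 \<and>
     bounded (range u0) \<and> bounded (range u1) \<and> bounded (range u2)"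

definition duhamel_solution ::
  "(real \<Rightarrow> real) \<Rightarrow> (real \<Rightarrow> complex) \<Rightarrow> real \<Rightarrow> (real \<Rightarrow> real \<Rightarrow> complex) \<Rightarrow> bool" where
  "duhamel_solution \<phi> u0 T u \<longleftrightarrow>
     (\<forall>t\<in>{0..T}. \<forall>x.
        schr_converges t u0 x \<and>
        (\<forall>\<tau>\<in>{0..t}. schr_converges (t - \<tau>) (nonlin \<phi> (u \<tau>)) x) \<and>
        set_integrable lborel {0..t} (\<lambda>\<tau>. schr (t - \<tau>) (nonlin \<phi> (u \<tau>)) x) \<and>
        u t x = schr t u0 x
                - \<i> * (LINT \<tau>:{0..t}|lborel. schr (t - \<tau>) (nonlin \<phi> (u \<tau>)) x))"

definition sup_norm :: "(real \<Rightarrow> complex) \<Rightarrow> real" where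
  "sup_norm f = (SUP x. cmod (f x))"

end

theory Submission
  imports
    Defs
    "HOL-Probability.Sinc_Integral"
    "HOL-Complex_Analysis.Cauchy_Integral_Theorem"
    "HOL-Real_Asymp.Real_Asymp"
begin

text \<open>
  Substituting \<open>y = x + sqrt t * z\<close> turns the free evolution of \<open>f\<close> into the oscillatory integral
  of \<open>exp (\<i> z\<^sup>2 / 4) * f (x + sqrt t * z)\<close>, divided by its value for \<open>f = 1\<close>, the Fresnel integral.
  If \<open>f\<close>, \<open>f'\<close>, \<open>f''\<close> are bounded by \<open>K\<close>, two integrations by parts bound the part over
  \<open>z \<ge> M\<close> by a multiple of \<open>K / M\<close>, uniformly in \<open>x\<close> and in \<open>t \<le> 1\<close>.  Hence the evolution is
  bounded by a multiple of \<open>K\<close>, and it is jointly uniformly continuous with a modulus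
  that depends only on \<open>K\<close>, since the truncated integrals are.  Convolution with \<open>\<phi>\<close> makes the
  nonlinearity locally Lipschitz from bounded functions to functions with two
  bounded derivatives, so the Duhamel map contracts a ball of bounded continuous functions for small time.
\<close>

section \<open>Oscillatory integrals with a chirp\<close>

text \<open>The datum is merely bounded, so the kernel integral need not converge absolutely and
  there is no L2 theory to lean on. Only oscillation yields convergence, at the price of two
  derivatives: a bound on \<open>f\<close>, \<open>f'\<close>, \<open>f''\<close> gives back no more
  than a sup bound on the evolved function. The free evolution alone therefore cannot be iterated.
  The Duhamel map can, because the outer convolution with \<open>\<phi>\<close> restores the two
  lost derivatives from a sup bound, and the datum enters the formula only once. A plain sup norm is
  thus the right norm for the contraction. Dividing by the Fresnel integral makes the rescaled
  formula valid at \<open>t = 0\<close> as well, so there is no initial layer to treat separately.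
  Since \<open>u0'\<close> is not among the quantities on which \<open>T\<close> may depend, its
  bound is recovered from those of \<open>u0\<close> and \<open>u0''\<close>.\<close>

definition chirp :: "real \<Rightarrow> complex" where
  "chirp z = exp (\<i> * complex_of_real (z\<^sup>2 / 4))"

text \<open>The derivatives are existentially quantified so that membership is a property of
  \<open>f\<close> alone. One constant serves all three orders, which keeps the class stable under
  the rescalings below.\<close>

definition C2_le :: "real \<Rightarrow> (real \<Rightarrow> complex) \<Rightarrow> bool" where
  "C2_le K f \<longleftrightarrow> (\<exists>f1 f2. (\<forall>x. (f has_vector_derivative f1 x) (at x)) \<and>
     (\<forall>x. (f1 has_vector_derivative f2 x) (at x)) \<and> continuous_on UNIV f2 \<and>
     (\<forall>x. cmod (f x) \<le> K \<and> cmod (f1 x) \<le> K \<and> cmod (f2 x) \<le> K))"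

lemma norm_chirp [simp]: "cmod (chirp z) = 1"
  by (simp add: chirp_def norm_exp_eq_Re)

lemma chirp_minus [simp]: "chirp (- z) = chirp z"
  by (simp add: chirp_def)

lemma continuous_on_chirp [continuous_intros]:
  "continuous_on A f \<Longrightarrow> continuous_on A (\<lambda>x. chirp (f x))"
  unfolding chirp_def by (intro continuous_intros) auto

lemma chirp_has_vector_derivative:
  "(chirp has_vector_derivative (\<i> * of_real z / 2 * chirp z)) (at z within S)"
proof -
  have "((\<lambda>w::complex. exp (\<i> * (w\<^sup>2 / 4))) has_field_derivative
      (\<i> * of_real z / 2 * exp (\<i> * ((of_real z)\<^sup>2 / 4)))) (at (of_real z))"
    by (auto intro!: derivative_eq_intros)
  from has_vector_derivative_real_field[OF this] show ?thesis
    by (simp add: chirp_def[abs_def])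
qed

lemma C2_le_nonneg: "C2_le K f \<Longrightarrow> 0 \<le> K"
  unfolding C2_le_def by (meson norm_ge_zero order_trans)

lemma C2_le_bound: "C2_le K f \<Longrightarrow> cmod (f x) \<le> K"
  unfolding C2_le_def by blast

lemma C2_le_continuous: "C2_le K f \<Longrightarrow> continuous_on A f"
  unfolding C2_le_def
  by (meson continuous_at_imp_continuous_on has_vector_derivative_continuous)

text \<open>The chain rule only produces the factors \<open>s\<close> and \<open>s * s\<close>, of
  modulus at most 1. With \<open>s = sqrt t\<close> this is the source of the restriction to times
  \<open>t \<le> 1\<close>.\<close>

lemma C2_le_compose_affine:
  assumes "C2_le K f" "\<bar>s\<bar> \<le> 1"
  shows "C2_le K (\<lambda>z. f (x + s * z))"
proof -
  obtain f1 f2 where f: "\<And>x. (f has_vector_derivative f1 x) (at x)"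
    "\<And>x. (f1 has_vector_derivative f2 x) (at x)" "continuous_on UNIV f2"
    "\<And>x. cmod (f x) \<le> K" "\<And>x. cmod (f1 x) \<le> K" "\<And>x. cmod (f2 x) \<le> K"
    using assms(1) unfolding C2_le_def by blast
  have K: "0 \<le> K" using C2_le_nonneg assms(1) by blast
  have aff: "((\<lambda>z. x + s * z) has_vector_derivative s) (at z)" for z
    by (auto intro!: derivative_eq_intros)
  have d1: "((\<lambda>z. f (x + s * z)) has_vector_derivative s *\<^sub>R f1 (x + s * z)) (at z)" for z
    using vector_diff_chain_at[OF aff f(1)] by (simp add: o_def)
  have "((\<lambda>z. f1 (x + s * z)) has_vector_derivative s *\<^sub>R f2 (x + s * z)) (at z)" for z
    using vector_diff_chain_at[OF aff f(2)] by (simp add: o_def)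
  then have d2: "((\<lambda>z. s *\<^sub>R f1 (x + s * z)) has_vector_derivative s *\<^sub>R (s *\<^sub>R f2 (x + s * z))) (at z)" for z
    by (rule bounded_linear.has_vector_derivative[OF bounded_linear_scaleR_right])
  have c: "continuous_on UNIV (\<lambda>z. s *\<^sub>R (s *\<^sub>R f2 (x + s * z)))"
    by (intro continuous_intros continuous_on_compose2[OF f(3)]) auto
  have m: "\<bar>s\<bar> * c \<le> K" if "0 \<le> c" "c \<le> K" for c
    using mult_mono[OF assms(2) that(2)] K that by simp
  have k1: "cmod (s *\<^sub>R f1 y) \<le> K" for y
    unfolding norm_scaleR by (rule m[OF norm_ge_zero f(5)])
  have k2: "cmod (s *\<^sub>R (s *\<^sub>R f2 y)) \<le> K" for y
    unfolding norm_scaleR by (rule m[OF mult_nonneg_nonneg[OF abs_ge_zero norm_ge_zero] m[OF norm_ge_zero f(6)]])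
  show ?thesis unfolding C2_le_def
    using d1 d2 c f(4) k1 k2
    by (intro exI[of _ "\<lambda>z. s *\<^sub>R f1 (x + s * z)"] exI[of _ "\<lambda>z. s *\<^sub>R (s *\<^sub>R f2 (x + s * z))"]) blast
qed

lemma C2_le_reflect:
  assumes "C2_le K f" shows "C2_le K (\<lambda>z. f (- z))"
  using C2_le_compose_affine[OF assms, of "-1" 0] by simp

text \<open>Two integrations by parts, carried out through the approximate antiderivative \<open>P\<close>.\<close>

lemma chirp_tail:
  assumes f: "C2_le K g" and M: "1 \<le> M" "M \<le> M'"
  shows "cmod (integral {M..M'} (\<lambda>z. chirp z * g z)) \<le> 26 * K / M"
proof -
  obtain g1 g2 where g: "\<And>x. (g has_vector_derivative g1 x) (at x)"
    "\<And>x. (g1 has_vector_derivative g2 x) (at x)" "continuous_on UNIV g2"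
    "\<And>x. cmod (g x) \<le> K" "\<And>x. cmod (g1 x) \<le> K" "\<And>x. cmod (g2 x) \<le> K"
    using assms(1) unfolding C2_le_def by blast
  have K: "0 \<le> K" using C2_le_nonneg assms(1) by blast
  \<comment> \<open>As the chirp has derivative \<open>\<i> * z / 2\<close> times itself, dividing
    by this factor gives the first term of \<open>P\<close>. Its derivative leaves over
    \<open>g1\<close> with a coefficient of size \<open>2 / z\<close>; the term with
    \<open>4 / z\<^sup>2\<close> is chosen to cancel it. What remains is \<open>R\<close>, of order
    \<open>1 / z\<^sup>2\<close> and hence absolutely integrable.\<close>
  define P where "P = (\<lambda>z::real. chirp z * ((of_real (1 / z) * (- 2 * \<i>)) * g z + of_real (4 / z\<^sup>2) * g1 z))"
  define R where "R = (\<lambda>z::real. chirp z * (of_real (1 / z\<^sup>2) * (2 * \<i>) * g z - of_real (8 / z ^ 3) * g1 z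
      + of_real (4 / z\<^sup>2) * g2 z))"
  have d1: "((\<lambda>z. complex_of_real (1 / z)) has_vector_derivative of_real (- (1 / z\<^sup>2))) (at z within S)"
    if "z \<noteq> 0" for z S
    by (rule has_vector_derivative_of_real) (use that in \<open>auto intro!: derivative_eq_intros simp: power2_eq_square\<close>)
  have d2: "((\<lambda>z. complex_of_real (4 / z\<^sup>2)) has_vector_derivative of_real (- (8 / z ^ 3))) (at z within S)"
    if "z \<noteq> 0" for z S
    by (rule has_vector_derivative_of_real)
      (use that in \<open>auto intro!: derivative_eq_intros simp: power2_eq_square power3_eq_cube field_simps\<close>)
  have g': "(g has_vector_derivative g1 x) (at x within S)"
    "(g1 has_vector_derivative g2 x) (at x within S)" for x S
    using g(1,2) has_vector_derivative_at_within by blast+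
  have alg: "\<i> * w / 2 * (1 / w * (- 2 * \<i>)) = 1" "\<i> * w / 2 * (4 / w\<^sup>2) = 2 * \<i> / w" if "w \<noteq> 0" for w :: complex
    using that by (auto simp: field_simps power2_eq_square)
  have "(P has_vector_derivative (chirp z * g z + R z)) (at z within {M..M'})" if "z \<in> {M..M'}" for z
  proof -
    have z: "z \<noteq> 0" "complex_of_real z \<noteq> 0" using that M by auto
    note d = d1[OF z(1)] d2[OF z(1)]
    have "(P has_vector_derivative (chirp z * ((of_real (1 / z) * (- 2 * \<i>)) * g1 z + (of_real (- (1 / z\<^sup>2)) * (- 2 * \<i>)) * g z
       + (of_real (4 / z\<^sup>2) * g2 z + of_real (- (8 / z ^ 3)) * g1 z))
       + \<i> * of_real z / 2 * chirp z * ((of_real (1 / z) * (- 2 * \<i>)) * g z + of_real (4 / z\<^sup>2) * g1 z))) (at z within {M..M'})"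
      unfolding P_def
      by (intro has_vector_derivative_mult has_vector_derivative_add chirp_has_vector_derivative d g'
        has_vector_derivative_mult_left)
    also have "(chirp z * ((of_real (1 / z) * (- 2 * \<i>)) * g1 z + (of_real (- (1 / z\<^sup>2)) * (- 2 * \<i>)) * g z
       + (of_real (4 / z\<^sup>2) * g2 z + of_real (- (8 / z ^ 3)) * g1 z))
       + \<i> * of_real z / 2 * chirp z * ((of_real (1 / z) * (- 2 * \<i>)) * g z + of_real (4 / z\<^sup>2) * g1 z)) =
       R z + chirp z * ((\<i> * of_real z / 2 * (1 / of_real z * (- 2 * \<i>))) * g z
         + (\<i> * of_real z / 2 * (4 / (of_real z)\<^sup>2) - 2 * \<i> / of_real z) * g1 z)"
      unfolding R_def of_real_divide of_real_minus of_real_power of_real_numeral of_real_1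
      by (simp add: algebra_simps)
    also have "\<dots> = chirp z * g z + R z"
      unfolding alg[OF z(2)] by simp
    finally show ?thesis .
  qed
  from fundamental_theorem_of_calculus[OF M(2) this]
  have I1: "((\<lambda>z. chirp z * g z + R z) has_integral (P M' - P M)) {M..M'}" .
  have cg: "continuous_on A g" "continuous_on A g1" "continuous_on A g2" for A
    using g(1,2) g(3) by (auto intro: continuous_at_imp_continuous_on has_vector_derivative_continuous continuous_on_subset)
  have cR: "continuous_on {M..M'} R" unfolding R_def
    by (intro continuous_intros cg) (use M in auto)
  then have iR: "R integrable_on {M..M'}" by (rule integrable_continuous_real)
  have eq: "integral {M..M'} (\<lambda>z. chirp z * g z) = (P M' - P M) - integral {M..M'} R"
    using has_integral_diff[OF I1 integrable_integral[OF iR]] by (auto dest: integral_unique)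
  have PM: "cmod (P z) \<le> 6 * K / M" if "M \<le> z" for z
  proof -
    have z: "1 \<le> z" using that M by auto
    have "cmod (P z) \<le> 2 / z * cmod (g z) + 4 / z\<^sup>2 * cmod (g1 z)"
      unfolding P_def norm_mult norm_chirp mult_1
      by (rule order_trans[OF norm_triangle_ineq]) (use z in \<open>simp add: norm_mult norm_divide norm_power\<close>)
    also have "\<dots> \<le> 2 / z * K + 4 / z\<^sup>2 * K"
      by (intro add_mono mult_left_mono g) (use z in auto)
    also have "4 / z\<^sup>2 \<le> 4 / z" using z by (auto simp: power2_eq_square field_simps)
    then have "2 / z * K + 4 / z\<^sup>2 * K \<le> 2 / z * K + 4 / z * K"
      using K by (intro add_mono mult_right_mono) auto
    also have "\<dots> = 6 * K / z" using z by (simp add: field_simps)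
    also have "\<dots> \<le> 6 * K / M" using that M K by (intro divide_left_mono) auto
    finally show ?thesis .
  qed
  note PM = PM[OF M(2)] PM[OF order_refl]
  \<comment> \<open>For \<open>z \<ge> 1\<close> the coefficients in \<open>R\<close> add up to 2 +
    8 + 4 = 14. Together with 6 = 2 + 4 from each of the two boundary values of \<open>P\<close>
    they make up the 26 of the statement.\<close>
  have J: "((\<lambda>z. 14 * K / z\<^sup>2) has_integral (14 * K * (- 1 / M') - 14 * K * (- 1 / M))) {M..M'}"
    by (rule fundamental_theorem_of_calculus[OF M(2)])
      (use M in \<open>auto intro!: derivative_eq_intros simp: has_real_derivative_iff_has_vector_derivative[symmetric] power2_eq_square\<close>)
  have "cmod (integral {M..M'} R) \<le> integral {M..M'} (\<lambda>z. 14 * K / z\<^sup>2)"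
  proof (rule integral_norm_bound_integral[OF iR])
    show "(\<lambda>z. 14 * K / z\<^sup>2) integrable_on {M..M'}" using J by blast
    fix z assume "z \<in> {M..M'}"
    then have z: "1 \<le> z" using M by auto
    have "cmod (R z) \<le> 2 / z\<^sup>2 * cmod (g z) + 8 / z ^ 3 * cmod (g1 z) + 4 / z\<^sup>2 * cmod (g2 z)"
      unfolding R_def norm_mult norm_chirp mult_1
      by (rule order_trans[OF norm_triangle_ineq], rule add_mono, rule order_trans[OF norm_triangle_ineq4])
        (use z in \<open>simp_all add: norm_mult norm_divide norm_power\<close>)
    also have "\<dots> \<le> 2 / z\<^sup>2 * K + 8 / z ^ 3 * K + 4 / z\<^sup>2 * K"
      by (intro add_mono mult_left_mono g) (use z in auto)
    also have "8 / z ^ 3 \<le> 8 / z\<^sup>2" using z by (auto simp: power2_eq_square power3_eq_cube field_simps)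
    then have "2 / z\<^sup>2 * K + 8 / z ^ 3 * K + 4 / z\<^sup>2 * K \<le> 2 / z\<^sup>2 * K + 8 / z\<^sup>2 * K + 4 / z\<^sup>2 * K"
      using K by (intro add_mono mult_right_mono) auto
    also have "\<dots> = 14 * K / z\<^sup>2" using z by (simp add: field_simps)
    finally show "cmod (R z) \<le> 14 * K / z\<^sup>2" .
  qed
  also have "\<dots> = (14 * K * (- 1 / M') - 14 * K * (- 1 / M))"
    using J by (rule integral_unique)
  also have "\<dots> \<le> 14 * K / M" using K M by simp
  finally have "cmod (integral {M..M'} R) \<le> 14 * K / M" .
  moreover have "cmod (P M' - P M - integral {M..M'} R) \<le> cmod (P M') + cmod (P M) + cmod (integral {M..M'} R)"
    using norm_triangle_ineq4[of "P M' - P M" "integral {M..M'} R"] norm_triangle_ineq4[of "P M'" "P M"] by linarith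
  moreover have "26 * K / M = 6 * K / M + 6 * K / M + 14 * K / M" by (simp add: field_simps)
  ultimately show ?thesis unfolding eq using PM by linarith
qed

text \<open>The improper integral over the line. Absolute convergence may fail, so it is a limit
  over symmetric windows with integer ends; \<open>osc_tail\<close> then frees it from that choice
  of windows.\<close>

definition osc :: "(real \<Rightarrow> complex) \<Rightarrow> complex" where
  "osc g = lim (\<lambda>n. integral {- real n..real n} (\<lambda>z. chirp z * g z))"

lemma chirp_integrable:
  "C2_le K g \<Longrightarrow> (\<lambda>z. chirp z * g z) integrable_on {a..b}"
  by (intro integrable_continuous_real continuous_intros C2_le_continuous)

text \<open>The chirp is even, so reflection turns the left tail into a right tail of the reflected
  function, and each side costs 26.\<close>

lemma chirp_outer:
  assumes g: "C2_le K g" and M: "1 \<le> M" "a \<le> - M" "M \<le> b"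
  shows "cmod (integral {a..b} (\<lambda>z. chirp z * g z) - integral {-M..M} (\<lambda>z. chirp z * g z)) \<le> 52 * K / M"
proof -
  let ?h = "\<lambda>z. chirp z * g z"
  note i = chirp_integrable[OF g]
  have "integral {a..b} ?h = integral {a..-M} ?h + integral {-M..b} ?h"
    using M by (intro Henstock_Kurzweil_Integration.integral_combine[symmetric] i) auto
  also have "integral {-M..b} ?h = integral {-M..M} ?h + integral {M..b} ?h"
    using M by (intro Henstock_Kurzweil_Integration.integral_combine[symmetric] i) auto
  also have "integral {a..-M} ?h = integral {M..-a} (\<lambda>z. chirp z * g (- z))"
    using Henstock_Kurzweil_Integration.integral_reflect_real[where f="\<lambda>z. chirp z * g (- z)" and a=M and b="-a"] by simp
  finally have "integral {a..b} ?h - integral {-M..M} ?h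
      = integral {M..-a} (\<lambda>z. chirp z * g (- z)) + integral {M..b} ?h" by simp
  moreover have "cmod \<dots> \<le> 26 * K / M + 26 * K / M"
    using M by (intro norm_triangle_mono chirp_tail C2_le_reflect g) auto
  ultimately show ?thesis by simp
qed

lemma osc_LIMSEQ:
  assumes g: "C2_le K g"
  shows "(\<lambda>n. integral {- real n..real n} (\<lambda>z. chirp z * g z)) \<longlonglongrightarrow> osc g"
proof -
  let ?J = "\<lambda>n. integral {- real n..real n} (\<lambda>z. chirp z * g z)"
  have K: "0 \<le> K" using C2_le_nonneg[OF g] .
  have "Cauchy ?J"
  proof (rule metric_CauchyI)
    fix e :: real assume e: "0 < e"
    obtain N :: nat where N: "real N > 104 * K / e + 1" using reals_Archimedean2 by blast
    then have N1: "1 \<le> real N" using e K by (smt (verit) divide_nonneg_pos)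
    have "52 * K / N < e / 2"
    proof -
      have "104 * K / e < N" using N by linarith
      then show ?thesis using e N1 by (simp add: field_simps)
    qed
    then have *: "dist (?J n) (?J N) < e / 2" if "n \<ge> N" for n
      using chirp_outer[OF g N1, of "- real n" "real n"] that by (simp add: dist_norm)
    show "\<exists>M. \<forall>m\<ge>M. \<forall>n\<ge>M. dist (?J m) (?J n) < e"
    proof (intro exI allI impI)
      fix m n assume "N \<le> m" "N \<le> n"
      then show "dist (?J m) (?J n) < e"
        using dist_triangle_half_l[OF *[of m], of "?J n"] *[of n] by (simp add: dist_commute)
    qed
  qed
  then show ?thesis unfolding osc_def
    using Cauchy_convergent_iff convergent_LIMSEQ_iff by blast
qed

text \<open>Both the given window and the limit are compared with \<open>{-M..M}\<close>, at cost 52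
  each. Windows off centre are needed because a symmetric window in \<open>y\<close> becomes one in
  \<open>z\<close> that is centred at \<open>- x / sqrt t\<close>.\<close>

lemma osc_tail:
  assumes g: "C2_le K g" and M: "1 \<le> M" "a \<le> - M" "M \<le> b"
  shows "cmod (integral {a..b} (\<lambda>z. chirp z * g z) - osc g) \<le> 104 * K / M"
proof -
  let ?J = "\<lambda>n. integral {- real n..real n} (\<lambda>z. chirp z * g z)"
  let ?h = "\<lambda>z. chirp z * g z"
  have "cmod (osc g - integral {-M..M} ?h) \<le> 52 * K / M"
  proof (rule tendsto_upperbound)
    show "(\<lambda>n. cmod (?J n - integral {-M..M} ?h)) \<longlonglongrightarrow> cmod (osc g - integral {-M..M} ?h)"
      by (intro tendsto_intros osc_LIMSEQ[OF g])
    obtain N :: nat where N: "real N \<ge> M" using real_arch_simple by blast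
    show "\<forall>\<^sub>F n in sequentially. cmod (?J n - integral {-M..M} ?h) \<le> 52 * K / M"
      using eventually_ge_at_top[of N]
      by eventually_elim (rule chirp_outer[OF g M(1)], use N in auto)
  qed auto
  moreover have "cmod (integral {a..b} ?h - integral {-M..M} ?h) \<le> 52 * K / M"
    by (rule chirp_outer[OF g M])
  ultimately have "cmod ((integral {a..b} ?h - integral {-M..M} ?h) - (osc g - integral {-M..M} ?h))
      \<le> 52 * K / M + 52 * K / M"
    by (rule norm_triangle_le_diff[OF add_mono[rotated]])
  then show ?thesis by simp
qed

lemma osc_eqI:
  assumes g: "C2_le K g" and "(\<lambda>n. integral {- real n..real n} (\<lambda>z. chirp z * g z)) \<longlonglongrightarrow> L"
  shows "osc g = L"
  using LIMSEQ_unique[OF osc_LIMSEQ[OF g] assms(2)] .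

text \<open>Cutting at \<open>M = 1\<close> gives 2 from the length of the window and 104 from the
  tails.\<close>

lemma osc_bound:
  assumes g: "C2_le K g"
  shows "cmod (osc g) \<le> 106 * K"
proof -
  have "cmod (integral {-1..1} (\<lambda>z. chirp z * g z)) \<le> K * (1 - (-1))"
    by (intro integral_bound continuous_intros C2_le_continuous[OF g])
      (auto simp: norm_mult C2_le_bound[OF g])
  moreover have "cmod (integral {-1..1} (\<lambda>z. chirp z * g z) - osc g) \<le> 104 * K / 1"
    by (rule osc_tail[OF g]) auto
  ultimately show ?thesis
    using norm_triangle_sub[of "osc g" "integral {-1..1} (\<lambda>z. chirp z * g z)"]
    by (simp add: norm_minus_commute)
qed

lemma osc_diff:
  assumes "C2_le K g" "C2_le K' h"
  shows "osc (\<lambda>z. g z - h z) = osc g - osc h"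
proof -
  have "(\<lambda>n. integral {- real n..real n} (\<lambda>z. chirp z * g z) - integral {- real n..real n} (\<lambda>z. chirp z * h z))
      = (\<lambda>n. integral {- real n..real n} (\<lambda>z. chirp z * (g z - h z)))"
    using chirp_integrable assms
    by (auto simp: right_diff_distrib Henstock_Kurzweil_Integration.integral_diff)
  with tendsto_diff[OF osc_LIMSEQ[OF assms(1)] osc_LIMSEQ[OF assms(2)]]
  have "(\<lambda>n. integral {- real n..real n} (\<lambda>z. chirp z * (g z - h z))) \<longlonglongrightarrow> osc g - osc h" by simp
  then show ?thesis unfolding osc_def by (rule limI)
qed

section \<open>The Fresnel integral and the free evolution\<close>

lemma C2_le_const: "C2_le (cmod c) (\<lambda>_. c)"
  unfolding C2_le_def by (intro exI[of _ "\<lambda>_. 0"]) auto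

lemma C2_le_lipschitz:
  assumes "C2_le K f"
  shows "cmod (f a - f b) \<le> K * \<bar>a - b\<bar>"
proof -
  obtain f1 where f: "\<And>x. (f has_vector_derivative f1 x) (at x)" "\<And>x. cmod (f1 x) \<le> K"
    using assms(1) unfolding C2_le_def by blast
  have "norm (f a - f b) \<le> K * norm (a - b)"
  proof (rule differentiable_bound[of UNIV f "\<lambda>x y. y *\<^sub>R f1 x"])
    show "(f has_derivative (\<lambda>y. y *\<^sub>R f1 x)) (at x within UNIV)" for x
      using f(1)[of x] by (simp add: has_vector_derivative_def)
    show "onorm (\<lambda>y. y *\<^sub>R f1 x) \<le> K" for x
      by (rule onorm_le) (use f(2)[of x] in \<open>simp add: mult.commute[of K] mult_left_mono\<close>)
  qed auto
  then show ?thesis by simp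
qed

text \<open>The principal square root of \<open>4 * pi * \<i>\<close>, and at the same time the
  integral of the chirp over the line, by \<open>osc_one\<close>.\<close>

definition fresnel_const :: complex where
  "fresnel_const = of_real (sqrt (2 * pi)) * (1 + \<i>)"

lemma norm_fresnel_const: "1 \<le> cmod fresnel_const"
proof -
  have "1 \<le> sqrt (2 * pi)" using pi_gt3 by simp
  moreover have "1 \<le> cmod (1 + \<i>)" by (simp add: cmod_def)
  ultimately show ?thesis unfolding fresnel_const_def norm_mult
    using mult_mono[of 1 "sqrt (2 * pi)" 1 "cmod (1 + \<i>)"] by simp
qed

lemma csqrt_fresnel_const:
  assumes "0 < t"
  shows "csqrt (4 * complex_of_real pi * \<i> * complex_of_real t) = of_real (sqrt t) * fresnel_const"
proof -
  have "(of_real (sqrt t) * fresnel_const)\<^sup>2 = (of_real ((sqrt t)\<^sup>2 * (sqrt (2 * pi))\<^sup>2)) * (1 + \<i>)\<^sup>2"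
    unfolding fresnel_const_def by (simp only: power_mult_distrib of_real_mult of_real_power mult.assoc)
  also have "(sqrt t)\<^sup>2 * (sqrt (2 * pi))\<^sup>2 = t * (2 * pi)" using assms by simp
  also have "(1 + \<i>)\<^sup>2 = 2 * \<i>" by (simp add: power2_eq_square algebra_simps)
  also have "of_real (t * (2 * pi)) * (2 * \<i>) = 4 * complex_of_real pi * \<i> * complex_of_real t"
    by simp
  finally have eq: "4 * complex_of_real pi * \<i> * complex_of_real t = (of_real (sqrt t) * fresnel_const)\<^sup>2" ..
  show ?thesis unfolding eq
    \<comment> \<open>The positive real part selects the principal branch.\<close>
    by (rule csqrt_square) (use assms in \<open>simp add: fresnel_const_def\<close>)
qed

text \<open>This is the integral met on the diagonal in \<open>osc_one\<close>:
  \<open>(1 + \<i>)\<^sup>2 = 2 * \<i>\<close> turns the exponent of the chirp into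
  \<open>- r\<^sup>2 / 2\<close>. It follows from the standard Gaussian by the scaling
  \<open>1 / sqrt 2\<close>.\<close>

lemma half_gaussian_LIMSEQ:
  "(\<lambda>n. integral {0..real n} (\<lambda>r. exp (- r\<^sup>2 / 2))) \<longlonglongrightarrow> sqrt (2 * pi) / 2"
proof -
  let ?f = "\<lambda>x. indicator {0..} x *\<^sub>R exp (- x\<^sup>2) :: real"
  let ?g = "\<lambda>x. indicator {0..} x *\<^sub>R exp (- x\<^sup>2 / 2) :: real"
  have eq: "?f (0 + (1 / sqrt 2) * x) = ?g x" for x
    by (auto simp: indicator_def power_divide zero_le_divide_iff)
  have "has_bochner_integral lborel (\<lambda>x. ?f (0 + (1 / sqrt 2) * x)) ((sqrt pi / 2) /\<^sub>R \<bar>1 / sqrt 2\<bar>)"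
    by (intro lborel_has_bochner_integral_real_affine_iff[THEN iffD1, OF _ gaussian_moment_0]) simp
  then have g: "has_bochner_integral lborel ?g (sqrt (2 * pi) / 2)"
    unfolding eq by (simp add: real_sqrt_mult)
  have "((\<lambda>y. \<integral>x. indicator {..y} x *\<^sub>R ?g x \<partial>lborel) \<longlongrightarrow> (\<integral>x. ?g x \<partial>lborel)) at_top"
    by (intro tendsto_integral_at_top) (use g in \<open>auto simp: has_bochner_integral_iff\<close>)
  then have "((\<lambda>y. \<integral>x. indicator {..y} x *\<^sub>R ?g x \<partial>lborel) \<longlongrightarrow> sqrt (2 * pi) / 2) at_top"
    unfolding has_bochner_integral_integral_eq[OF g] .
  from filterlim_compose[OF this filterlim_real_sequentially]
  have lim: "(\<lambda>n. \<integral>x. indicator {..real n} x *\<^sub>R ?g x \<partial>lborel) \<longlonglongrightarrow> sqrt (2 * pi) / 2" .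
  have "(\<integral>x. indicator {..real n} x *\<^sub>R ?g x \<partial>lborel) = integral {0..real n} (\<lambda>r. exp (- r\<^sup>2 / 2))" for n
  proof -
    have "(\<integral>x. indicator {..real n} x *\<^sub>R ?g x \<partial>lborel) = (LINT x:{0..real n}|lborel. exp (- x\<^sup>2 / 2))"
      unfolding set_lebesgue_integral_def
      by (intro Bochner_Integration.integral_cong) (auto simp: indicator_def)
    also have "\<dots> = integral {0..real n} (\<lambda>r. exp (- r\<^sup>2 / 2))"
      by (intro set_borel_integral_eq_integral borel_integrable_atLeastAtMost' continuous_intros) auto
    finally show ?thesis .
  qed
  with lim show ?thesis by simp
qed

text \<open>The contour is rotated onto the diagonal, where the chirp becomes a Gaussian;
  on the vertical segment joining \<open>R\<close> to \<open>R + \<i>R\<close> it decays like \<open>exp (- R y / 2)\<close>.\<close>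

lemma osc_one: "osc (\<lambda>_. 1) = fresnel_const"
proof (rule osc_eqI)
  show "C2_le 1 (\<lambda>_. 1)" using C2_le_const[of 1] by simp
  let ?e = "\<lambda>w::complex. exp (\<i> * (w\<^sup>2 / 4))"
  have "?e holomorphic_on UNIV" by (intro holomorphic_intros) auto
  \<comment> \<open>With an entire primitive every contour integral is a difference of values of
    \<open>F\<close>, so path independence is mere telescoping.\<close>
  then obtain F where F: "\<And>w. (F has_field_derivative ?e w) (at w)"
    using holomorphic_convex_primitive'[of UNIV ?e] by auto
  have path: "((\<lambda>r. F (p + of_real r * q)) has_vector_derivative (q * ?e (p + of_real r * q))) (at r within S)"
    for p q r S
  proof -
    have "((\<lambda>r. p + of_real r * q) has_vector_derivative q) (at r within S)"
      by (auto intro!: derivative_eq_intros)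
    from field_vector_diff_chain_within[OF this has_field_derivative_at_within[OF F]]
    show ?thesis by (simp add: o_def)
  qed
  have path_int: "((\<lambda>r. q * ?e (p + of_real r * q)) has_integral (F (p + of_real R * q) - F p)) {0..R}"
    if "0 \<le> R" for p q R
    using fundamental_theorem_of_calculus[OF that path[of p q]] by simp
  have hor: "integral {0..R} chirp = F (of_real R) - F 0" if "0 \<le> R" for R
    using path_int[OF that, of 1 0] by (intro integral_unique) (simp add: chirp_def[abs_def])
  have diag: "(1 + \<i>) * of_real (integral {0..R} (\<lambda>r. exp (- r\<^sup>2 / 2))) = F (of_real R * (1 + \<i>)) - F 0" if "0 \<le> R" for R
  proof -
    have e: "?e (0 + of_real r * (1 + \<i>)) = of_real (exp (- r\<^sup>2 / 2))" for r
      unfolding exp_of_real[symmetric] by (rule arg_cong[of _ _ exp]) (simp add: power2_eq_square algebra_simps)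
    have "(\<lambda>r. exp (- r\<^sup>2 / 2)) integrable_on {0..R}"
      by (intro integrable_continuous_real continuous_intros) auto
    from has_integral_mult_right[OF has_integral_of_real[OF integrable_integral[OF this]], of "1 + \<i>"]
    show ?thesis using path_int[OF that, of "1 + \<i>" 0] unfolding e by (simp add: has_integral_unique)
  qed
  have vert: "cmod (F (of_real R * (1 + \<i>)) - F (of_real R)) \<le> 2 / R" if R: "0 < R" for R
  proof -
    have I: "((\<lambda>y. \<i> * ?e (of_real R + of_real y * \<i>)) has_integral (F (of_real R * (1 + \<i>)) - F (of_real R))) {0..R}"
      using path_int[of R \<i> "of_real R"] R by (simp add: algebra_simps)
    have J: "((\<lambda>y. exp (- R * y / 2)) has_integral (- (2 / R) * exp (- R * R / 2) - - (2 / R) * exp (- R * 0 / 2))) {0..R}"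
      by (rule fundamental_theorem_of_calculus)
        (use R in \<open>auto intro!: derivative_eq_intros simp: has_real_derivative_iff_has_vector_derivative[symmetric]\<close>)
    have "cmod (F (of_real R * (1 + \<i>)) - F (of_real R)) \<le> (- (2 / R) * exp (- R * R / 2) - - (2 / R) * exp (- R * 0 / 2))"
    proof -
      have "cmod (\<i> * ?e (of_real R + of_real y * \<i>)) \<le> exp (- R * y / 2) \<bullet> 1" for y
        by (simp add: norm_mult norm_exp_eq_Re power2_eq_square algebra_simps)
      from has_integral_norm_bound_integral_component[OF I J this] show ?thesis by simp
    qed
    also have "\<dots> \<le> 2 / R" using R by simp
    finally show ?thesis .
  qed
  have sym: "integral {- real n..real n} (\<lambda>z. chirp z * 1) = 2 * integral {0..real n} chirp" for n
  proof -
    have i: "chirp integrable_on {a..b}" for a b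
      by (intro integrable_continuous_real continuous_intros)
    have "integral {- real n..real n} chirp = integral {- real n..0} chirp + integral {0..real n} chirp"
      by (intro Henstock_Kurzweil_Integration.integral_combine[symmetric] i) auto
    also have "integral {- real n..0} chirp = integral {0..real n} chirp"
      using Henstock_Kurzweil_Integration.integral_reflect_real[where f="chirp" and a=0 and b="real n"] by simp
    finally show ?thesis by simp
  qed
  have lim0: "(\<lambda>n. F (of_real (real n) * (1 + \<i>)) - F (of_real (real n))) \<longlonglongrightarrow> 0"
  proof (rule Lim_null_comparison)
    show "\<forall>\<^sub>F n in sequentially. cmod (F (of_real (real n) * (1 + \<i>)) - F (of_real (real n))) \<le> 2 / real n"
      using eventually_gt_at_top[of 0] by eventually_elim (rule vert, simp)
    show "(\<lambda>n. 2 / real n) \<longlonglongrightarrow> 0" by (rule lim_const_over_n)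
  qed
  have "(\<lambda>n. 2 * ((1 + \<i>) * of_real (integral {0..real n} (\<lambda>r. exp (- r\<^sup>2 / 2)))
       - (F (of_real (real n) * (1 + \<i>)) - F (of_real (real n))))) \<longlonglongrightarrow> 2 * ((1 + \<i>) * of_real (sqrt (2 * pi) / 2) - 0)"
    by (intro tendsto_intros half_gaussian_LIMSEQ lim0)
  also have "2 * ((1 + \<i>) * of_real (sqrt (2 * pi) / 2) - 0) = fresnel_const"
    unfolding fresnel_const_def by simp
  also have "(\<lambda>n. 2 * ((1 + \<i>) * of_real (integral {0..real n} (\<lambda>r. exp (- r\<^sup>2 / 2)))
       - (F (of_real (real n) * (1 + \<i>)) - F (of_real (real n)))))
     = (\<lambda>n. integral {- real n..real n} (\<lambda>z. chirp z * 1))"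
    unfolding sym using diag hor by simp
  finally show "(\<lambda>n. integral {- real n..real n} (\<lambda>z. chirp z * 1)) \<longlonglongrightarrow> fresnel_const" .
qed

text \<open>At \<open>t = 0\<close> the rescaled function \<open>f (x + sqrt t * z)\<close> is
  constant in \<open>z\<close>; this value makes the formula for the evolution return
  \<open>f x\<close>.\<close>

lemma osc_const: "osc (\<lambda>_. c) = fresnel_const * c"
proof (rule osc_eqI[OF C2_le_const])
  have "(\<lambda>n. integral {- real n..real n} (\<lambda>z. chirp z * 1) * c) \<longlonglongrightarrow> osc (\<lambda>_. 1) * c"
    by (intro tendsto_intros osc_LIMSEQ[OF C2_le_const])
  then show "(\<lambda>n. integral {- real n..real n} (\<lambda>z. chirp z * c)) \<longlonglongrightarrow> fresnel_const * c"
    by (simp add: osc_one)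
qed

text \<open>The Jacobian \<open>sqrt t\<close> cancels against the same factor in the square root of
  the kernel, leaving no singularity in \<open>t\<close>.\<close>

lemma schr_trunc_eq:
  assumes f: "C2_le K f" and t: "0 < t" and R: "0 \<le> R"
  shows "schr_trunc t f x R =
    integral {(- R - x) / sqrt t..(R - x) / sqrt t} (\<lambda>z. chirp z * f (x + sqrt t * z)) / fresnel_const"
proof -
  let ?s = "sqrt t" and ?a = "(- R - x) / sqrt t" and ?b = "(R - x) / sqrt t"
  let ?h = "\<lambda>y. exp (\<i> * complex_of_real ((x - y)\<^sup>2 / (4 * t))) * f y"
  have s: "0 < ?s" "?s\<^sup>2 = t" using t by auto
  have ch: "continuous_on A ?h" for A
    by (intro continuous_intros C2_le_continuous[OF f]) (use t in auto)
  have "((\<lambda>z. ?s *\<^sub>R ?h (x + ?s * z)) has_integral integral {x + ?s * ?a..x + ?s * ?b} ?h) {?a..?b}"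
  proof (rule has_integral_substitution[where c="- R" and d=R])
    show "?a \<le> ?b" using s R by (simp add: divide_right_mono)
    show "(\<lambda>z. x + ?s * z) ` {?a..?b} \<subseteq> {- R..R}"
      using s by (auto simp: field_simps)
    show "((\<lambda>z. x + ?s * z) has_real_derivative ?s) (at z within {?a..?b})" for z
      by (auto intro!: derivative_eq_intros)
    show "x + ?s * ?a \<le> x + ?s * ?b" using s R by simp
  qed (rule ch)
  also have "x + ?s * ?a = - R" using s by simp
  also have "x + ?s * ?b = R" using s by simp
  also have "(\<lambda>z. ?s *\<^sub>R ?h (x + ?s * z)) = (\<lambda>z. of_real ?s * (chirp z * f (x + ?s * z)))"
  proof
    fix z
    have "(x - (x + ?s * z))\<^sup>2 / (4 * t) = z\<^sup>2 / 4"
      using s t by (simp add: power_mult_distrib)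
    then show "?s *\<^sub>R ?h (x + ?s * z) = of_real ?s * (chirp z * f (x + ?s * z))"
      by (simp only: chirp_def scaleR_conv_of_real)
  qed
  finally have hi: "((\<lambda>z. of_real ?s * (chirp z * f (x + ?s * z))) has_integral integral {- R..R} ?h) {?a..?b}" .
  have "integral {- R..R} ?h = of_real ?s * integral {?a..?b} (\<lambda>z. chirp z * f (x + ?s * z))"
    using integral_unique[OF hi] by (simp only: integral_mult_right)
  moreover have "(LINT y:{-R..R}|lborel. ?h y) = integral {- R..R} ?h"
    by (intro set_borel_integral_eq_integral borel_integrable_atLeastAtMost' ch)
  ultimately show ?thesis
    unfolding schr_trunc_def csqrt_fresnel_const[OF t] using s by simp
qed

lemma schr_trunc_tendsto:
  assumes f: "C2_le K f" and t: "0 < t" "t \<le> 1"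
  shows "(schr_trunc t f x \<longlongrightarrow> osc (\<lambda>z. f (x + sqrt t * z)) / fresnel_const) at_top"
proof -
  let ?s = "sqrt t"
  have s: "0 < ?s" "\<bar>?s\<bar> \<le> 1" "?s \<le> 1" using t by auto
  let ?J = "\<lambda>R. integral {(- R - x) / ?s..(R - x) / ?s} (\<lambda>z. chirp z * f (x + ?s * z))"
  have g: "C2_le K (\<lambda>z. f (x + ?s * z))" by (rule C2_le_compose_affine[OF f s(2)])
  have "((\<lambda>R. ?J R - osc (\<lambda>z. f (x + ?s * z))) \<longlongrightarrow> 0) at_top"
  proof (rule Lim_null_comparison)
    \<comment> \<open>The shifted window contains the symmetric one of half-width
      \<open>(R - \<bar>x\<bar>) / sqrt t\<close>. For \<open>R \<ge> \<bar>x\<bar> + 1\<close> and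
      \<open>t \<le> 1\<close> this is at least 1, as the tail estimate demands.\<close>
    show "\<forall>\<^sub>F R in at_top. cmod (?J R - osc (\<lambda>z. f (x + ?s * z))) \<le> 104 * K / ((R - \<bar>x\<bar>) / ?s)"
      using eventually_ge_at_top[of "\<bar>x\<bar> + 1"]
    proof eventually_elim
      case (elim R)
      show ?case
      proof (rule osc_tail[OF g])
        show "1 \<le> (R - \<bar>x\<bar>) / ?s" unfolding le_divide_eq using elim s by (simp del: real_sqrt_le_1_iff)
        show "(- R - x) / ?s \<le> - ((R - \<bar>x\<bar>) / ?s)"
          unfolding minus_divide_left by (intro divide_right_mono) (use s in auto)
        show "(R - \<bar>x\<bar>) / ?s \<le> (R - x) / ?s"
          by (intro divide_right_mono) (use s in auto)
      qed
    qed
    have "filterlim (\<lambda>R. (R - \<bar>x\<bar>) / ?s) at_top at_top"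
      using s(1) by real_asymp
    then show "((\<lambda>R. 104 * K / ((R - \<bar>x\<bar>) / ?s)) \<longlongrightarrow> 0) at_top"
      by (rule real_tendsto_divide_at_top[OF tendsto_const])
  qed
  then have "(?J \<longlongrightarrow> osc (\<lambda>z. f (x + ?s * z))) at_top"
    by (rule LIM_zero_cancel)
  then have lim: "((\<lambda>R. ?J R / fresnel_const) \<longlongrightarrow> osc (\<lambda>z. f (x + ?s * z)) / fresnel_const) at_top"
    using norm_fresnel_const by (intro tendsto_intros) auto
  show ?thesis
    by (rule Lim_transform_eventually[OF lim])
      (use eventually_ge_at_top[of "0::real"] in \<open>eventually_elim, simp add: schr_trunc_eq[OF f t(1)]\<close>)
qed

section \<open>Sup bound, linearity and equicontinuity of the free evolution\<close>

lemma schr_converges: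
  "C2_le K f \<Longrightarrow> 0 \<le> t \<Longrightarrow> t \<le> 1 \<Longrightarrow> schr_converges t f x"
  unfolding schr_converges_def using schr_trunc_tendsto[of K f t x] by (cases "t = 0") auto

lemma schr_eq:
  assumes f: "C2_le K f" and t: "0 \<le> t" "t \<le> 1"
  shows "schr t f x = osc (\<lambda>z. f (x + sqrt t * z)) / fresnel_const"
proof (cases "t = 0")
  case True
  then show ?thesis using norm_fresnel_const by (auto simp: schr_def osc_const)
next
  case False
  with t have t: "0 < t" "t \<le> 1" by auto
  show ?thesis unfolding schr_def
    using False tendsto_Lim[OF _ schr_trunc_tendsto[OF f t]] by simp
qed

lemma schr_bound:
  assumes f: "C2_le K f" and t: "0 \<le> t" "t \<le> 1"
  shows "cmod (schr t f x) \<le> 106 * K"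
proof -
  have "cmod (osc (\<lambda>z. f (x + sqrt t * z))) \<le> 106 * K"
    using t by (intro osc_bound C2_le_compose_affine[OF f]) auto
  moreover have "cmod w / cmod fresnel_const \<le> cmod w" for w
    using norm_fresnel_const mult_left_mono[OF norm_fresnel_const norm_ge_zero[of w]] by (simp add: divide_le_eq)
  ultimately show ?thesis
    unfolding schr_eq[OF assms] norm_divide using order_trans by blast
qed

lemma schr_diff:
  assumes f: "C2_le K f" "C2_le K' g" "C2_le K'' (\<lambda>x. f x - g x)" and t: "0 \<le> t" "t \<le> 1"
  shows "schr t (\<lambda>x. f x - g x) x = schr t f x - schr t g x"
proof -
  have "osc (\<lambda>z. f (x + sqrt t * z) - g (x + sqrt t * z)) = osc (\<lambda>z. f (x + sqrt t * z)) - osc (\<lambda>z. g (x + sqrt t * z))"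
    using t by (intro osc_diff[OF C2_le_compose_affine[OF f(1)] C2_le_compose_affine[OF f(2)]]) auto
  then show ?thesis using schr_eq f t by (simp add: schr_eq diff_divide_distrib)
qed

text \<open>The radius \<open>d\<close> is fixed before \<open>f\<close>, so that one modulus serves
  all time slices of a forcing term at once under the Duhamel integral.\<close>

lemma schr_equicontinuous:
  assumes "0 < e"
  obtains d where "0 < d"
    "\<And>f t t' x x'. C2_le K f \<Longrightarrow> t \<in> {0..1} \<Longrightarrow> t' \<in> {0..1} \<Longrightarrow> \<bar>t - t'\<bar> < d \<Longrightarrow> \<bar>x - x'\<bar> < d \<Longrightarrow>
      cmod (schr t f x - schr t' f x') < e"
proof (cases "0 \<le> K")
  \<comment> \<open>A negative \<open>K\<close> admits no \<open>f\<close> at all.\<close>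
  case False
  then show ?thesis using that[of 1] C2_le_nonneg by force
next
  case K: True
  \<comment> \<open>The cutoff makes each of the two tails, of size \<open>104 * K / M\<close>,
    smaller than \<open>e / 4\<close>.\<close>
  define M where "M = 416 * K / e + 1"
  have M: "1 \<le> M" using K assms by (simp add: M_def)
  have MK: "104 * K / M < e / 4"
  proof -
    have "416 * K / e < M" by (simp add: M_def)
    then show ?thesis using assms M by (simp add: field_simps)
  qed
  \<comment> \<open>On the window of length \<open>2 * M\<close> the arguments of \<open>f\<close>
    differ by at most \<open>(1 + M) * \<eta>\<close>, which the Lipschitz constant \<open>K\<close>
    turns into an error below \<open>e / 2\<close>. Writing \<open>K + 1\<close> avoids a zero
    denominator and makes the estimate strict.\<close>
  define \<eta> where "\<eta> = min 1 (e / (4 * M * (1 + M) * (K + 1)))"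
  have \<eta>: "0 < \<eta>" "\<eta> \<le> 1" "\<eta> \<le> e / (4 * M * (1 + M) * (K + 1))"
    using assms M K by (auto simp: \<eta>_def)
  have small: "K * ((1 + M) * \<eta>) * (M - - M) < e / 2"
  proof -
    have pos: "0 < 4 * M * (1 + M) * (K + 1)" using M K by simp
    have "\<eta> * (4 * M * (1 + M) * (K + 1)) \<le> e"
      using \<eta>(3) pos by (simp add: pos_le_divide_eq)
    moreover have "\<eta> * (4 * M * (1 + M) * (K + 1)) = 2 * (K * ((1 + M) * \<eta>) * (M - - M)) + 4 * M * (1 + M) * \<eta>"
      by (simp add: algebra_simps)
    moreover have "0 < 4 * M * (1 + M) * \<eta>" using M \<eta> by simp
    ultimately show ?thesis by linarith
  qed
  show ?thesis
  \<comment> \<open>The square appears because \<open>sqrt\<close> is only Hoelder continuous of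
    order 1/2 at 0; in \<open>x\<close> it does no harm, since
    \<open>\<eta> \<le> 1\<close>.\<close>
  proof (rule that[of "\<eta>\<^sup>2"])
    show "0 < \<eta>\<^sup>2" using \<eta> by simp
    fix f t t' x x'
    assume f: "C2_le K f" and t: "t \<in> {0..1}" "t' \<in> {0..1}" and d: "\<bar>t - t'\<bar> < \<eta>\<^sup>2" "\<bar>x - x'\<bar> < \<eta>\<^sup>2"
    let ?g = "\<lambda>z. f (x + sqrt t * z)" and ?g' = "\<lambda>z. f (x' + sqrt t' * z)"
    have g: "C2_le K ?g" "C2_le K ?g'"
      using t by (auto intro!: C2_le_compose_affine[OF f])
    have sq: "\<bar>sqrt t - sqrt t'\<bar> \<le> \<eta>"
    proof (rule power2_le_imp_le)
      have "\<bar>sqrt t - sqrt t'\<bar>\<^sup>2 \<le> \<bar>sqrt t - sqrt t'\<bar> * (sqrt t + sqrt t')"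
        unfolding power2_eq_square using t by (intro mult_left_mono) (auto simp: abs_le_iff)
      also have "\<dots> = \<bar>(sqrt t - sqrt t') * (sqrt t + sqrt t')\<bar>"
        using t by (simp add: abs_mult)
      also have "(sqrt t - sqrt t') * (sqrt t + sqrt t') = t - t'"
        using t by (simp add: algebra_simps)
      finally show "\<bar>sqrt t - sqrt t'\<bar>\<^sup>2 \<le> \<eta>\<^sup>2" using d by linarith
    qed (use \<eta> in auto)
    have dx: "\<bar>x - x'\<bar> \<le> \<eta>"
    proof -
      have "\<eta> * \<eta> \<le> \<eta> * 1" using \<eta> by (intro mult_left_mono) auto
      then show ?thesis using d(2) by (simp add: power2_eq_square)
    qed
    have "cmod (integral {-M..M} (\<lambda>z. chirp z * (?g z - ?g' z))) \<le> (K * ((1 + M) * \<eta>)) * (M - - M)"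
    proof (rule integral_bound)
      show "- M \<le> M" using M by simp
      show "continuous_on {- M..M} (\<lambda>z. chirp z * (?g z - ?g' z))"
        by (intro continuous_intros C2_le_continuous[OF g(1)] C2_le_continuous[OF g(2)])
      fix z assume z: "z \<in> {- M..M}"
      have "cmod (chirp z * (?g z - ?g' z)) \<le> K * \<bar>(x + sqrt t * z) - (x' + sqrt t' * z)\<bar>"
        unfolding norm_mult norm_chirp mult_1 by (rule C2_le_lipschitz[OF f])
      also have "\<dots> \<le> K * ((1 + M) * \<eta>)"
      proof (rule mult_left_mono[OF _ K])
        have "(x + sqrt t * z) - (x' + sqrt t' * z) = (x - x') + (sqrt t - sqrt t') * z"
          by (simp add: algebra_simps)
        also have "\<bar>\<dots>\<bar> \<le> \<bar>x - x'\<bar> + \<bar>sqrt t - sqrt t'\<bar> * \<bar>z\<bar>"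
          by (metis abs_mult abs_triangle_ineq)
        also have "\<dots> \<le> \<eta> + \<eta> * M"
          by (intro add_mono mult_mono dx sq) (use z \<eta> in auto)
        finally show "\<bar>(x + sqrt t * z) - (x' + sqrt t' * z)\<bar> \<le> (1 + M) * \<eta>"
          by (simp add: algebra_simps)
      qed
      finally show "cmod (chirp z * (?g z - ?g' z)) \<le> K * ((1 + M) * \<eta>)" .
    qed
    also have "integral {-M..M} (\<lambda>z. chirp z * (?g z - ?g' z))
      = integral {-M..M} (\<lambda>z. chirp z * ?g z) - integral {-M..M} (\<lambda>z. chirp z * ?g' z)"
      by (simp add: right_diff_distrib Henstock_Kurzweil_Integration.integral_diff[OF chirp_integrable[OF g(1)] chirp_integrable[OF g(2)]])
    finally have "cmod (integral {-M..M} (\<lambda>z. chirp z * ?g z) - integral {-M..M} (\<lambda>z. chirp z * ?g' z)) < e / 2"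
      using small by linarith
    moreover have "cmod (integral {-M..M} (\<lambda>z. chirp z * ?g z) - osc ?g) \<le> 104 * K / M"
      "cmod (integral {-M..M} (\<lambda>z. chirp z * ?g' z) - osc ?g') \<le> 104 * K / M"
      by (intro osc_tail g M; simp)+
    moreover have tri: "cmod (p - q) \<le> cmod (a - b) + cmod (a - p) + cmod (b - q)" for a b p q :: complex
      by norm
    ultimately have *: "cmod (osc ?g - osc ?g') < e"
      using MK tri[of "osc ?g" "osc ?g'" "integral {-M..M} (\<lambda>z. chirp z * ?g z)" "integral {-M..M} (\<lambda>z. chirp z * ?g' z)"]
      by linarith
    have "cmod (schr t f x - schr t' f x') = cmod (osc ?g - osc ?g') / cmod fresnel_const"
      using t by (simp add: schr_eq[OF f] norm_divide[symmetric] diff_divide_distrib)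
    also have "\<dots> \<le> cmod (osc ?g - osc ?g')"
      using norm_fresnel_const mult_left_mono[OF norm_fresnel_const norm_ge_zero[of "osc ?g - osc ?g'"]]
      by (simp add: divide_le_eq)
    finally show "cmod (schr t f x - schr t' f x') < e" using * by linarith
  qed
qed

section \<open>Convolution with a decaying kernel\<close>

lemma
  shows integrable_inverse_square: "integrable lborel (\<lambda>y::real. 1 / (1 + y\<^sup>2))"
    and integral_inverse_square: "(\<integral>y. 1 / (1 + y\<^sup>2) \<partial>lborel) = pi"
proof -
  have e: "einterval (- \<infinity>) \<infinity> = UNIV" by auto
  show "integrable lborel (\<lambda>y::real. 1 / (1 + y\<^sup>2))"
    using integrable_inverse_1_plus_square unfolding e set_integrable_def by (simp add: inverse_eq_divide)
  show "(\<integral>y. 1 / (1 + y\<^sup>2) \<partial>lborel) = pi"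
    using LBINT_inverse_1_plus_square
    unfolding interval_lebesgue_integral_def e set_lebesgue_integral_def by (simp add: inverse_eq_divide)
qed

text \<open>Through this criterion, differentiating a convolution reduces to integrating the Taylor
  remainder of the kernel.\<close>

lemma has_vector_derivativeI_quadratic:
  fixes F :: "real \<Rightarrow> 'a::real_normed_vector"
  assumes "\<And>h. \<bar>h\<bar> \<le> 1 \<Longrightarrow> norm (F (x + h) - F x - h *\<^sub>R F') \<le> B * h\<^sup>2"
  shows "(F has_vector_derivative F') (at x)"
  unfolding has_vector_derivative_def has_derivative_at
proof
  show "bounded_linear (\<lambda>h. h *\<^sub>R F')" by (rule bounded_linear_scaleR_left)
  show "((\<lambda>h. norm (F (x + h) - F x - h *\<^sub>R F') / norm h) \<longlongrightarrow> 0) (at 0)"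
  proof (rule Lim_null_comparison)
    show "((\<lambda>h. B * \<bar>h\<bar>) \<longlongrightarrow> 0) (at (0::real))"
      by (auto intro!: tendsto_eq_intros)
    have "\<forall>\<^sub>F h in at (0::real). h \<in> {-1<..<1} - {0}"
      by (rule eventually_at_in_open) auto
    then show "\<forall>\<^sub>F h in at 0. norm (norm (F (x + h) - F x - h *\<^sub>R F') / norm h) \<le> B * \<bar>h\<bar>"
    proof eventually_elim
      case (elim h)
      then have "norm (F (x + h) - F x - h *\<^sub>R F') \<le> B * h\<^sup>2" by (intro assms) auto
      then show ?case using elim by (simp add: divide_le_eq power2_eq_square mult.assoc abs_mult[symmetric])
    qed
  qed
qed

text \<open>The mean value inequality is applied twice, to \<open>f1\<close> and then to
  \<open>f\<close> minus its linear part. The bound on \<open>f2\<close> is asked only within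
  distance \<open>\<bar>h\<bar>\<close> of \<open>z\<close>, so that for a decaying kernel
  \<open>B\<close> may decay in \<open>z\<close>.\<close>

lemma taylor_quadratic:
  fixes f :: "real \<Rightarrow> 'a::real_normed_vector"
  assumes d: "\<And>x. (f has_vector_derivative f1 x) (at x)" "\<And>x. (f1 has_vector_derivative f2 x) (at x)"
    and B: "\<And>s. \<bar>s\<bar> \<le> \<bar>h\<bar> \<Longrightarrow> norm (f2 (z + s)) \<le> B"
  shows "norm (f (z + h) - f z - h *\<^sub>R f1 z) \<le> B * h\<^sup>2"
proof -
  let ?S = "{- \<bar>h\<bar>..\<bar>h\<bar>}"
  have B0: "0 \<le> B" using order_trans[OF norm_ge_zero B[of 0]] by simp
  have shift: "((\<lambda>s. z + s) has_vector_derivative 1) (at s within ?S)" for s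
    by (auto intro!: derivative_eq_intros)
  have d': "((\<lambda>s. f (z + s)) has_vector_derivative f1 (z + s)) (at s within ?S)"
    "((\<lambda>s. f1 (z + s)) has_vector_derivative f2 (z + s)) (at s within ?S)" for s
    using vector_diff_chain_within[OF shift has_vector_derivative_at_within[OF d(1)], of s]
      vector_diff_chain_within[OF shift has_vector_derivative_at_within[OF d(2)], of s]
    by (simp_all only: o_def scaleR_one)
  have ons: "onorm (\<lambda>y. y *\<^sub>R w) \<le> norm w" for w :: 'a
    by (rule onorm_le) (simp add: mult.commute)
  have b1: "norm (f1 (z + s) - f1 z) \<le> B * \<bar>h\<bar>" if "s \<in> ?S" for s
  proof -
    have "norm (f1 (z + s) - f1 (z + 0)) \<le> B * norm (s - 0)"
      proof (rule differentiable_bound[of ?S "\<lambda>s. f1 (z + s)" "\<lambda>s y. y *\<^sub>R f2 (z + s)"])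
      show "((\<lambda>s. f1 (z + s)) has_derivative (\<lambda>y. y *\<^sub>R f2 (z + s))) (at s within ?S)" for s
        using d'(2) unfolding has_vector_derivative_def .
      show "onorm (\<lambda>y. y *\<^sub>R f2 (z + s)) \<le> B" if "s \<in> ?S" for s
        by (rule order_trans[OF ons B]) (use that in auto)
    qed (use that in auto)
    also have "\<dots> \<le> B * \<bar>h\<bar>" using that B0 by (intro mult_left_mono) (auto simp: abs_le_iff)
    finally show ?thesis by simp
  qed
  have d3: "((\<lambda>s. f (z + s) - s *\<^sub>R f1 z) has_vector_derivative (f1 (z + s) - f1 z)) (at s within ?S)" for s
    by (rule has_vector_derivative_diff[OF d'(1)]) (auto intro!: derivative_eq_intros)
  have "norm ((f (z + h) - h *\<^sub>R f1 z) - (f (z + 0) - 0 *\<^sub>R f1 z)) \<le> B * \<bar>h\<bar> * norm (h - 0)"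
  proof (rule differentiable_bound[of ?S "\<lambda>s. f (z + s) - s *\<^sub>R f1 z" "\<lambda>s y. y *\<^sub>R (f1 (z + s) - f1 z)"])
    show "((\<lambda>s. f (z + s) - s *\<^sub>R f1 z) has_derivative (\<lambda>y. y *\<^sub>R (f1 (z + s) - f1 z))) (at s within ?S)" for s
      using d3 unfolding has_vector_derivative_def .
    show "onorm (\<lambda>y. y *\<^sub>R (f1 (z + s) - f1 z)) \<le> B * \<bar>h\<bar>" if "s \<in> ?S" for s
      by (rule order_trans[OF ons b1[OF that]])
  qed auto
  then show ?thesis by (simp add: power2_eq_square algebra_simps abs_mult[symmetric])
qed

lemma conv_swap: "conv f g x = (\<integral>y. f (x - y) * g y \<partial>lborel)"
  unfolding conv_def using lborel_integral_real_affine[of "-1" "\<lambda>y. f y * g (x - y)" x] by simp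

section \<open>The cubic nonlinearity and its smoothing by a decaying kernel\<close>

definition cubic :: "complex \<Rightarrow> complex" where
  "cubic a = complex_of_real ((cmod a)\<^sup>2) * a"

lemma continuous_on_cubic [continuous_intros]:
  "continuous_on A f \<Longrightarrow> continuous_on A (\<lambda>x. cubic (f x))"
  unfolding cubic_def by (intro continuous_intros)

lemma norm_cubic: "cmod (cubic a) = cmod a ^ 3"
  by (simp add: cubic_def norm_mult norm_power power2_eq_square power3_eq_cube)

text \<open>The difference splits into \<open>|a|^2 (a - b)\<close> and
  \<open>(|a|^2 - |b|^2) b\<close>; the first contributes 1 and the second 2 to the factor
  3.\<close>

lemma cubic_lipschitz:
  assumes "cmod a \<le> m" "cmod b \<le> m"
  shows "cmod (cubic a - cubic b) \<le> 3 * m\<^sup>2 * cmod (a - b)"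
proof -
  have m: "0 \<le> m" using assms(1) norm_ge_zero order_trans by blast
  have "cubic a - cubic b = of_real ((cmod a)\<^sup>2) * (a - b) + of_real ((cmod a - cmod b) * (cmod a + cmod b)) * b"
    unfolding cubic_def by (simp add: algebra_simps power2_eq_square)
  then have "cmod (cubic a - cubic b) \<le> cmod (of_real ((cmod a)\<^sup>2) * (a - b))
      + cmod (of_real ((cmod a - cmod b) * (cmod a + cmod b)) * b)"
    by (simp only: norm_triangle_ineq)
  also have "\<dots> = (cmod a)\<^sup>2 * cmod (a - b) + \<bar>cmod a - cmod b\<bar> * (cmod a + cmod b) * cmod b"
    unfolding norm_mult norm_of_real by (simp add: abs_mult)
  also have "\<dots> \<le> m\<^sup>2 * cmod (a - b) + cmod (a - b) * (m + m) * m"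
    by (intro add_mono mult_mono power_mono assms norm_triangle_ineq3) (use m in auto)
  also have "\<dots> = 3 * m\<^sup>2 * cmod (a - b)" by (simp add: algebra_simps power2_eq_square)
  finally show ?thesis .
qed

text \<open>\<open>D n\<close> stands for the \<open>n\<close>-th derivative of
  \<open>\<phi>\<close>. Decay up to order 4 enters as follows: continuity of the second derivative
  of a convolution is obtained by differentiating it once more, and the remainder estimate for that
  step involves \<open>D 4\<close>.\<close>

locale decaying_kernel =
  fixes D :: "nat \<Rightarrow> real \<Rightarrow> real" and C :: real
  assumes deriv: "\<And>n y. (D n has_real_derivative D (Suc n) y) (at y)"
    and decay: "\<And>n y. n \<le> 4 \<Longrightarrow> \<bar>D n y\<bar> \<le> C / (1 + y\<^sup>2)"
begin

definition kconv :: "nat \<Rightarrow> (real \<Rightarrow> complex) \<Rightarrow> real \<Rightarrow> complex" where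
  "kconv n = conv (\<lambda>y. complex_of_real (D n y))"

lemma C_nonneg: "0 \<le> C"
  using decay[of 0 0] by simp

lemma D_continuous: "continuous_on A (D n)"
  by (intro continuous_at_imp_continuous_on ballI DERIV_isCont[OF deriv])

lemma D_measurable [measurable]: "D n \<in> borel_measurable borel"
  by (rule borel_measurable_continuous_onI[OF D_continuous])

text \<open>The weight has integral \<open>pi\<close>, rounded up to 4. Every factor
  \<open>4 * C\<close> below comes from here.\<close>

lemma dominated_integrable:
  fixes f :: "real \<Rightarrow> complex"
  assumes "f \<in> borel_measurable borel" "\<And>y. cmod (f y) \<le> M / (1 + y\<^sup>2)"
  shows "integrable lborel f" "cmod (\<integral>y. f y \<partial>lborel) \<le> 4 * M"
proof -
  have i: "integrable lborel (\<lambda>y. M / (1 + y\<^sup>2))"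
    using integrable_mult_right[OF integrable_inverse_square, of M] by simp
  show f: "integrable lborel f"
  proof (rule Bochner_Integration.integrable_bound[OF i])
    show "f \<in> borel_measurable lborel" using assms(1) by simp
    show "AE y in lborel. cmod (f y) \<le> norm (M / (1 + y\<^sup>2))"
      by (intro AE_I2 order_trans[OF assms(2)]) (simp only: real_norm_def abs_ge_self)
  qed
  have M: "0 \<le> M" using order_trans[OF norm_ge_zero assms(2)[of 0]] by simp
  have "cmod (\<integral>y. f y \<partial>lborel) \<le> (\<integral>y. M / (1 + y\<^sup>2) \<partial>lborel)"
    by (rule Bochner_Integration.integral_norm_bound_integral[OF f i assms(2)])
  also have "\<dots> = M * pi"
    using Bochner_Integration.integral_mult_right_zero[of lborel M "\<lambda>y. 1 / (1 + y\<^sup>2)"] by (simp add: integral_inverse_square)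
  also have "\<dots> \<le> M * 4" using M pi_less_4 by (intro mult_left_mono) auto
  finally show "cmod (\<integral>y. f y \<partial>lborel) \<le> 4 * M" by simp
qed

lemma kernel_product_bound:
  assumes "n \<le> 4" "cmod w \<le> G"
  shows "cmod (complex_of_real (D n y) * w) \<le> C * G / (1 + y\<^sup>2)"
proof -
  have "cmod (complex_of_real (D n y) * w) \<le> C / (1 + y\<^sup>2) * G"
    unfolding norm_mult norm_of_real using C_nonneg
    by (intro mult_mono decay assms) auto
  then show ?thesis by simp
qed

lemma kconv_integrable:
  assumes "n \<le> 4" and g: "continuous_on UNIV g" "\<And>x. cmod (g x) \<le> G"
  shows "integrable lborel (\<lambda>y. complex_of_real (D n y) * g (x - y))"
proof -
  have [measurable]: "g \<in> borel_measurable borel" by (rule borel_measurable_continuous_onI[OF g(1)])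
  show ?thesis
    by (rule dominated_integrable(1)[OF _ kernel_product_bound[OF assms(1) g(2)]]) measurable
qed

lemma kconv_bound:
  assumes "n \<le> 4" and g: "continuous_on UNIV g" "\<And>x. cmod (g x) \<le> G"
  shows "cmod (kconv n g x) \<le> 4 * C * G"
proof -
  have [measurable]: "g \<in> borel_measurable borel" by (rule borel_measurable_continuous_onI[OF g(1)])
  have "cmod (kconv n g x) \<le> 4 * (C * G)"
    unfolding kconv_def conv_def
    by (rule dominated_integrable(2)[OF _ kernel_product_bound[OF assms(1) g(2)]]) measurable
  then show ?thesis by simp
qed

lemma kconv_diff:
  assumes "n \<le> 4" and g: "continuous_on UNIV g" "\<And>x. cmod (g x) \<le> G"
    and h: "continuous_on UNIV h" "\<And>x. cmod (h x) \<le> H"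
  shows "kconv n (\<lambda>x. g x - h x) x = kconv n g x - kconv n h x"
  unfolding kconv_def conv_def
  using Bochner_Integration.integral_diff[OF kconv_integrable[OF assms(1) g] kconv_integrable[OF assms(1) h]]
  by (simp add: right_diff_distrib)

lemma kernel_taylor:
  assumes "n \<le> 2" "\<bar>h\<bar> \<le> 1"
  shows "\<bar>D n (z + h) - D n z - h * D (Suc n) z\<bar> \<le> 3 * C / (1 + z\<^sup>2) * h\<^sup>2"
proof -
  have "norm (D n (z + h) - D n z - h *\<^sub>R D (Suc n) z) \<le> 3 * C / (1 + z\<^sup>2) * h\<^sup>2"
  proof (rule taylor_quadratic)
    show "(D n has_vector_derivative D (Suc n) x) (at x)"
      "(D (Suc n) has_vector_derivative D (Suc (Suc n)) x) (at x)" for x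
      using deriv by (simp_all add: has_real_derivative_iff_has_vector_derivative)
    fix s assume s: "\<bar>s\<bar> \<le> \<bar>h\<bar>"
    have "s\<^sup>2 \<le> 1" using s assms(2) by (simp add: abs_square_le_1)
    \<comment> \<open>Completing the square shows that a shift by at most 1 changes the weight by a
      factor of at most 3.\<close>
    moreover have "3 * (1 + (z + s)\<^sup>2) - (1 + z\<^sup>2) = 2 * (1 - s\<^sup>2) + 2 * (z + 3 / 2 * s)\<^sup>2 + s\<^sup>2 / 2"
      by (simp add: power2_eq_square algebra_simps)
    moreover have "0 \<le> 2 * (1 - s\<^sup>2) + 2 * (z + 3 / 2 * s)\<^sup>2 + s\<^sup>2 / 2"
      using \<open>s\<^sup>2 \<le> 1\<close> by (intro add_nonneg_nonneg) auto
    ultimately have "1 + z\<^sup>2 \<le> 3 * (1 + (z + s)\<^sup>2)"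
      by (metis diff_ge_0_iff_ge)
    then have "C / (1 + (z + s)\<^sup>2) \<le> 3 * C / (1 + z\<^sup>2)"
      using C_nonneg mult_left_mono[of "1 + z\<^sup>2" "3 * (1 + (z + s)\<^sup>2)" C]
      by (simp add: divide_le_eq le_divide_eq add_pos_nonneg algebra_simps)
    moreover have "\<bar>D (Suc (Suc n)) (z + s)\<bar> \<le> C / (1 + (z + s)\<^sup>2)"
      using assms(1) by (intro decay) auto
    ultimately show "norm (D (Suc (Suc n)) (z + s)) \<le> 3 * C / (1 + z\<^sup>2)" by simp
  qed
  then show ?thesis by simp
qed

text \<open>The difference quotient is moved onto the kernel, so boundedness and continuity of
  \<open>g\<close> suffice.\<close>

lemma kconv_has_vector_derivative:
  assumes "n \<le> 2" and g: "continuous_on UNIV g" "\<And>x. cmod (g x) \<le> G"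
  shows "(kconv n g has_vector_derivative kconv (Suc n) g x) (at x)"
proof (rule has_vector_derivativeI_quadratic)
  fix h :: real assume h: "\<bar>h\<bar> \<le> 1"
  have [measurable]: "g \<in> borel_measurable borel" by (rule borel_measurable_continuous_onI[OF g(1)])
  have G: "0 \<le> G" using g(2)[of 0] norm_ge_zero order_trans by blast
  let ?k = "\<lambda>n x y. complex_of_real (D n (x - y)) * g y"
  let ?d = "\<lambda>z. complex_of_real (D n (z + h) - D n z - h * D (Suc n) z)"
  have swap: "kconv m g x = (\<integral>y. ?k m x y \<partial>lborel)" for m x
    unfolding kconv_def by (rule conv_swap)
  have int: "integrable lborel (?k m x)" if "m \<le> 4" for m x
    using lborel_integrable_real_affine[OF kconv_integrable[OF that g, of x], of "-1" x] by simp
  have "kconv n g (x + h) - kconv n g x - h *\<^sub>R kconv (Suc n) g x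
      = (\<integral>y. ?k n (x + h) y - ?k n x y - of_real h * ?k (Suc n) x y \<partial>lborel)"
    unfolding swap scaleR_conv_of_real
    using int[of n "x + h"] int[of n x] int[of "Suc n" x] assms(1) by simp
  also have "\<dots> = (\<integral>y. ?d (x - y) * g y \<partial>lborel)"
    by (intro Bochner_Integration.integral_cong) (auto simp: algebra_simps)
  \<comment> \<open>Swapping back centres the Taylor remainder at 0, where its bound has the form of
    the dominating weight.\<close>
  also have "\<dots> = (\<integral>y. ?d y * g (x - y) \<partial>lborel)"
    using conv_swap[of ?d g x] by (simp add: conv_def)
  also have "cmod \<dots> \<le> 4 * (3 * C * h\<^sup>2 * G)"
  proof (rule dominated_integrable(2))
    fix y
    have "cmod (?d y * g (x - y)) \<le> 3 * C / (1 + y\<^sup>2) * h\<^sup>2 * G"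
      unfolding norm_mult norm_of_real using C_nonneg
      by (intro mult_mono kernel_taylor[OF assms(1) h] g) auto
    then show "cmod (?d y * g (x - y)) \<le> 3 * C * h\<^sup>2 * G / (1 + y\<^sup>2)" by simp
  qed measurable
  finally show "cmod (kconv n g (x + h) - kconv n g x - h *\<^sub>R kconv (Suc n) g x) \<le> 12 * C * G * h\<^sup>2"
    by (simp add: algebra_simps)
qed

lemma kconv_C2_le:
  assumes g: "continuous_on UNIV g" "\<And>x. cmod (g x) \<le> G"
  shows "C2_le (4 * C * G) (kconv 0 g)"
  unfolding C2_le_def
proof (intro exI conjI allI)
  show "(kconv 0 g has_vector_derivative kconv 1 g x) (at x)" for x
    using kconv_has_vector_derivative[OF _ g, of 0] by simp
  show "(kconv 1 g has_vector_derivative kconv 2 g x) (at x)" for x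
    using kconv_has_vector_derivative[OF _ g, of 1] by (simp add: numeral_2_eq_2)
  show "continuous_on UNIV (kconv 2 g)"
    using kconv_has_vector_derivative[OF _ g, of 2]
    by (auto intro!: continuous_at_imp_continuous_on has_vector_derivative_continuous)
qed (auto intro: kconv_bound[OF _ g])

text \<open>Dominated convergence along sequences, with a majorant independent of
  \<open>(t, x)\<close>.\<close>

lemma kconv_continuous_param:
  fixes w :: "real \<Rightarrow> real \<Rightarrow> complex"
  assumes c: "continuous_on UNIV (\<lambda>(t, x). w t x)" and G: "\<And>t x. cmod (w t x) \<le> G"
  shows "continuous_on UNIV (\<lambda>(t, x). kconv 0 (w t) x)"
proof (rule continuous_at_imp_continuous_on, safe, unfold continuous_at_sequentially, safe)
  fix t x and X :: "nat \<Rightarrow> real \<times> real"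
  assume X: "X \<longlonglongrightarrow> (t, x)"
  have cw: "continuous_on UNIV (w s)" for s
    by (rule continuous_on_compose2[OF c, of UNIV "\<lambda>x. (s, x)", simplified]) (intro continuous_intros)
  have [measurable]: "w s \<in> borel_measurable borel" for s by (rule borel_measurable_continuous_onI[OF cw])
  have "(\<lambda>n. \<integral>y. complex_of_real (D 0 y) * w (fst (X n)) (snd (X n) - y) \<partial>lborel)
     \<longlonglongrightarrow> (\<integral>y. complex_of_real (D 0 y) * w t (x - y) \<partial>lborel)"
  proof (rule integral_dominated_convergence[where w="\<lambda>y. C * G / (1 + y\<^sup>2)"])
    show "integrable lborel (\<lambda>y. C * G / (1 + y\<^sup>2))"
      using integrable_mult_right[OF integrable_inverse_square, of "C * G"] by simp
    show "AE y in lborel. (\<lambda>n. complex_of_real (D 0 y) * w (fst (X n)) (snd (X n) - y)) \<longlonglongrightarrow> complex_of_real (D 0 y) * w t (x - y)"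
    proof (intro AE_I2 tendsto_intros)
      fix y
      have "(\<lambda>n. (\<lambda>(t, x). w t x) (fst (X n), snd (X n) - y)) \<longlonglongrightarrow> (\<lambda>(t, x). w t x) (t, x - y)"
        by (rule continuous_on_tendsto_compose[OF c])
          (use tendsto_fst[OF X] tendsto_snd[OF X] in \<open>auto intro!: tendsto_intros\<close>)
      then show "(\<lambda>n. w (fst (X n)) (snd (X n) - y)) \<longlonglongrightarrow> w t (x - y)" by simp
    qed
    show "AE y in lborel. cmod (complex_of_real (D 0 y) * w (fst (X n)) (snd (X n) - y)) \<le> C * G / (1 + y\<^sup>2)" for n
      by (intro AE_I2 kernel_product_bound G) simp
  qed measurable
  then show "((\<lambda>(t, x). kconv 0 (w t) x) \<circ> X) \<longlonglongrightarrow> kconv 0 (w t) x"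
    by (simp add: kconv_def conv_def o_def case_prod_unfold)
qed

lemma nonlin_eq: "nonlin (D 0) v = kconv 0 (\<lambda>x. cubic (kconv 0 v x))"
  by (simp add: nonlin_def kconv_def cubic_def Let_def)

lemma cubic_kconv:
  assumes v: "continuous_on UNIV v" "\<And>x. cmod (v x) \<le> R"
  shows "continuous_on UNIV (\<lambda>x. cubic (kconv 0 v x))" "cmod (cubic (kconv 0 v x)) \<le> (4 * C * R) ^ 3"
  using C2_le_continuous[OF kconv_C2_le[OF v]]
  by (auto intro!: continuous_intros power_mono kconv_bound v simp: norm_cubic)

lemma nonlin_C2_le:
  assumes v: "continuous_on UNIV v" "\<And>x. cmod (v x) \<le> R"
  shows "C2_le (4 * C * (4 * C * R) ^ 3) (nonlin (D 0) v)"
  unfolding nonlin_eq by (intro kconv_C2_le cubic_kconv[OF v])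

text \<open>The outer convolution is linear, so a Lipschitz estimate in the sup norm for what it
  acts on is enough; the convolution upgrades it to two derivatives. The factors are, from the
  inside, the inner convolution, the cubic at size \<open>4 * C * R\<close>, and the outer
  convolution.\<close>

lemma nonlin_diff_C2_le:
  assumes v: "continuous_on UNIV v" "\<And>x. cmod (v x) \<le> R"
    and w: "continuous_on UNIV w" "\<And>x. cmod (w x) \<le> R"
    and d: "\<And>x. cmod (v x - w x) \<le> d"
  shows "C2_le (4 * C * (3 * (4 * C * R)\<^sup>2 * (4 * C * d))) (\<lambda>x. nonlin (D 0) v x - nonlin (D 0) w x)"
proof -
  note cv = cubic_kconv[OF v] and cw = cubic_kconv[OF w]
  have "cmod (cubic (kconv 0 v x) - cubic (kconv 0 w x)) \<le> 3 * (4 * C * R)\<^sup>2 * (4 * C * d)" for x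
  proof -
    have "cmod (cubic (kconv 0 v x) - cubic (kconv 0 w x)) \<le> 3 * (4 * C * R)\<^sup>2 * cmod (kconv 0 v x - kconv 0 w x)"
      by (intro cubic_lipschitz kconv_bound v w) auto
    also have "kconv 0 v x - kconv 0 w x = kconv 0 (\<lambda>x. v x - w x) x"
      by (rule kconv_diff[symmetric, OF _ v w]) simp
    also have "3 * (4 * C * R)\<^sup>2 * cmod \<dots> \<le> 3 * (4 * C * R)\<^sup>2 * (4 * C * d)"
      by (intro mult_left_mono kconv_bound d continuous_intros v w) auto
    finally show ?thesis .
  qed
  then have "C2_le (4 * C * (3 * (4 * C * R)\<^sup>2 * (4 * C * d))) (kconv 0 (\<lambda>x. cubic (kconv 0 v x) - cubic (kconv 0 w x)))"
    by (intro kconv_C2_le continuous_on_diff cv cw)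
  also have "kconv 0 (\<lambda>x. cubic (kconv 0 v x) - cubic (kconv 0 w x)) = (\<lambda>x. nonlin (D 0) v x - nonlin (D 0) w x)"
    unfolding nonlin_eq by (intro ext kconv_diff[OF _ cv cw]) simp
  finally show ?thesis .
qed

lemma nonlin_continuous_param:
  fixes v :: "real \<Rightarrow> real \<Rightarrow> complex"
  assumes c: "continuous_on UNIV (\<lambda>(t, x). v t x)" and R: "\<And>t x. cmod (v t x) \<le> R"
  shows "continuous_on UNIV (\<lambda>(t, x). nonlin (D 0) (v t) x)"
  unfolding nonlin_eq
proof (rule kconv_continuous_param)
  have "continuous_on UNIV (\<lambda>p. cubic ((\<lambda>(t, x). kconv 0 (v t) x) p))"
    by (rule continuous_on_cubic[OF kconv_continuous_param[OF assms]])
  then show "continuous_on UNIV (\<lambda>(t, x). cubic (kconv 0 (v t) x))" by (simp add: case_prod_unfold)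
  have cv: "continuous_on UNIV (v t)" for t
    by (rule continuous_on_compose2[OF c, of UNIV "\<lambda>x. (t, x)", simplified]) (intro continuous_intros)
  show "cmod (cubic (kconv 0 (v t) x)) \<le> (4 * C * R) ^ 3" for t x
    by (rule cubic_kconv(2)[OF cv R])
qed

end

section \<open>The Duhamel map\<close>

definition duhamel :: "(real \<Rightarrow> real \<Rightarrow> complex) \<Rightarrow> real \<Rightarrow> real \<Rightarrow> complex" where
  "duhamel f t x = (LINT \<tau>:{0..t}|lborel. schr (t - \<tau>) (f \<tau>) x)"

locale forcing =
  fixes f :: "real \<Rightarrow> real \<Rightarrow> complex" and K :: real
  assumes joint: "continuous_on UNIV (\<lambda>(\<tau>, x). f \<tau> x)" and C2: "\<And>\<tau>. C2_le K (f \<tau>)"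
begin

text \<open>Here the evolved function varies with \<open>\<tau>\<close> too, so equicontinuity for a
  fixed function does not apply. Instead the truncated integrals are continuous in
  \<open>\<tau>\<close> by joint continuity, and they converge at the uniform rate
  \<open>104 * K / n\<close>.\<close>

lemma continuous_on_schr:
  assumes t: "t \<le> 1"
  shows "continuous_on {0..t} (\<lambda>\<tau>. schr (t - \<tau>) (f \<tau>) x)"
proof -
  let ?g = "\<lambda>\<tau> z. f \<tau> (x + sqrt (t - \<tau>) * z)"
  have K: "0 \<le> K" using C2_le_nonneg[OF C2] .
  have g: "C2_le K (?g \<tau>)" if "\<tau> \<in> {0..t}" for \<tau>
    using that t by (intro C2_le_compose_affine[OF C2]) auto
  have "continuous_on {0..t} (\<lambda>\<tau>. osc (?g \<tau>))"
  proof (rule uniform_limit_theorem)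
    show "\<forall>\<^sub>F n in sequentially. continuous_on {0..t} (\<lambda>\<tau>. integral {- real n..real n} (\<lambda>z. chirp z * ?g \<tau> z))"
    proof (intro always_eventually allI)
      fix n :: nat
      have "continuous_on ({0..t} \<times> cbox (- real n) (real n)) (\<lambda>(\<tau>, z). chirp z * ?g \<tau> z)"
        unfolding case_prod_unfold
        by (intro continuous_intros continuous_on_compose2[OF joint[unfolded case_prod_unfold],
            of _ "\<lambda>p. (fst p, x + sqrt (t - fst p) * snd p)", simplified])
      from integral_continuous_on_param[OF this]
      show "continuous_on {0..t} (\<lambda>\<tau>. integral {- real n..real n} (\<lambda>z. chirp z * ?g \<tau> z))" by simp
    qed
    show "uniform_limit {0..t} (\<lambda>n \<tau>. integral {- real n..real n} (\<lambda>z. chirp z * ?g \<tau> z)) (\<lambda>\<tau>. osc (?g \<tau>)) sequentially"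
    proof (rule uniform_limitI)
      fix e :: real assume e: "0 < e"
      have "(\<lambda>n. 104 * K / real n) \<longlonglongrightarrow> 0" by (rule lim_const_over_n)
      from order_tendstoD(2)[OF this e] eventually_ge_at_top[of 1]
      show "\<forall>\<^sub>F n in sequentially. \<forall>\<tau>\<in>{0..t}. dist (integral {- real n..real n} (\<lambda>z. chirp z * ?g \<tau> z)) (osc (?g \<tau>)) < e"
      proof eventually_elim
        case (elim n)
        show ?case
        proof
          fix \<tau> assume "\<tau> \<in> {0..t}"
          have "cmod (integral {- real n..real n} (\<lambda>z. chirp z * ?g \<tau> z) - osc (?g \<tau>)) \<le> 104 * K / real n"
            by (rule osc_tail[OF g[OF \<open>\<tau> \<in> {0..t}\<close>]]) (use elim in auto)
          then show "dist (integral {- real n..real n} (\<lambda>z. chirp z * ?g \<tau> z)) (osc (?g \<tau>)) < e"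
            using elim by (simp add: dist_norm)
        qed
      qed
    qed
  qed simp
  then have "continuous_on {0..t} (\<lambda>\<tau>. osc (?g \<tau>) / fresnel_const)"
    using norm_fresnel_const by (intro continuous_intros) auto
  then show ?thesis
    by (rule continuous_on_eq) (use t in \<open>simp add: schr_eq[OF C2]\<close>)
qed

lemma set_integrable_schr:
  "t \<le> 1 \<Longrightarrow> set_integrable lborel {0..t} (\<lambda>\<tau>. schr (t - \<tau>) (f \<tau>) x)"
  by (rule borel_integrable_atLeastAtMost'[OF continuous_on_schr])

lemma duhamel_eq: "t \<le> 1 \<Longrightarrow> duhamel f t x = integral {0..t} (\<lambda>\<tau>. schr (t - \<tau>) (f \<tau>) x)"
  unfolding duhamel_def by (rule set_borel_integral_eq_integral(2)[OF set_integrable_schr])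

lemma duhamel_bound:
  assumes "0 \<le> t" "t \<le> 1"
  shows "cmod (duhamel f t x) \<le> 106 * K * t"
proof -
  have "cmod (integral {0..t} (\<lambda>\<tau>. schr (t - \<tau>) (f \<tau>) x)) \<le> 106 * K * (t - 0)"
    by (rule integral_bound[OF _ continuous_on_schr]) (use assms in \<open>auto intro!: schr_bound[OF C2]\<close>)
  then show ?thesis using assms by (simp add: duhamel_eq)
qed

text \<open>On the common time interval the same slice is evolved to two nearby points, which the
  uniform modulus controls; the rest of the longer interval is short and its integrand bounded by
  \<open>106 * K\<close>.\<close>

lemma duhamel_equicontinuous:
  assumes e: "0 < e"
  obtains d where "0 < d" "\<And>t t' x x'. t \<in> {0..1} \<Longrightarrow> t' \<in> {0..1} \<Longrightarrow> \<bar>t - t'\<bar> < d \<Longrightarrow> \<bar>x - x'\<bar> < d \<Longrightarrow>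
      cmod (duhamel f t x - duhamel f t' x') < e"
proof -
  have K: "0 \<le> K" using C2_le_nonneg[OF C2] .
  have "0 < e / 2" using e by simp
  then obtain d0 where d0: "0 < d0"
    "\<And>f t t' x x'. C2_le K f \<Longrightarrow> t \<in> {0..1} \<Longrightarrow> t' \<in> {0..1} \<Longrightarrow> \<bar>t - t'\<bar> < d0 \<Longrightarrow> \<bar>x - x'\<bar> < d0 \<Longrightarrow>
      cmod (schr t f x - schr t' f x') < e / 2"
    by (rule schr_equicontinuous[where K=K]) blast
  define d where "d = min d0 (e / (2 * (106 * K + 1)))"
  have d: "0 < d" "d \<le> d0" "d \<le> e / (2 * (106 * K + 1))" using d0(1) e K by (auto simp: d_def)
  have main: "cmod (duhamel f t x - duhamel f t' x') < e"
    if t: "0 \<le> t" "t \<le> t'" "t' \<le> 1" "t' - t < d" and x: "\<bar>x - x'\<bar> < d" for t t' x x'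
  proof -
    let ?s = "\<lambda>\<tau>. schr (t - \<tau>) (f \<tau>) x" and ?s' = "\<lambda>\<tau>. schr (t' - \<tau>) (f \<tau>) x'"
    have c: "continuous_on {0..t} ?s" "continuous_on {0..t'} ?s'"
      using t by (auto intro: continuous_on_schr)
    have c': "continuous_on {0..t} ?s'" "continuous_on {t..t'} ?s'"
      using t by (auto intro: continuous_on_subset[OF c(2)])
    have "integral {0..t'} ?s' = integral {0..t} ?s' + integral {t..t'} ?s'"
      using t by (intro Henstock_Kurzweil_Integration.integral_combine[symmetric] integrable_continuous_real c) auto
    then have eq: "duhamel f t x - duhamel f t' x' = integral {0..t} (\<lambda>\<tau>. ?s \<tau> - ?s' \<tau>) - integral {t..t'} ?s'"
      using t c(1) c'(1) by (simp add: duhamel_eq Henstock_Kurzweil_Integration.integral_diff integrable_continuous_real)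
    have "cmod (integral {0..t} (\<lambda>\<tau>. ?s \<tau> - ?s' \<tau>)) \<le> e / 2 * (t - 0)"
    proof (rule integral_bound)
      show "continuous_on {0..t} (\<lambda>\<tau>. ?s \<tau> - ?s' \<tau>)" by (intro continuous_intros c c')
      show "cmod (?s \<tau> - ?s' \<tau>) \<le> e / 2" if "\<tau> \<in> {0..t}" for \<tau>
        by (intro less_imp_le d0(2)[OF C2]) (use that t x d in auto)
    qed (use t in auto)
    also have "\<dots> \<le> e / 2 * 1" using t e by (intro mult_left_mono) auto
    finally have 1: "cmod (integral {0..t} (\<lambda>\<tau>. ?s \<tau> - ?s' \<tau>)) \<le> e / 2" by simp
    have "cmod (integral {t..t'} ?s') \<le> 106 * K * (t' - t)"
      by (rule integral_bound[OF t(2) c'(2)]) (use t in \<open>auto intro!: schr_bound[OF C2]\<close>)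
    also have "\<dots> \<le> 106 * K * d" using t K by (intro mult_left_mono) auto
    also have "\<dots> < (106 * K + 1) * d" using d(1) by (simp add: algebra_simps)
    also have "\<dots> \<le> e / 2" using d(3) K by (simp add: le_divide_eq mult.commute algebra_simps)
    finally have 2: "cmod (integral {t..t'} ?s') < e / 2" .
    show ?thesis unfolding eq using 1 2 norm_triangle_ineq4 by (smt (verit) field_sum_of_halves)
  qed
  show ?thesis
  proof (rule that[OF d(1)])
    fix t t' x x' :: real
    assume *: "t \<in> {0..1}" "t' \<in> {0..1}" "\<bar>t - t'\<bar> < d" "\<bar>x - x'\<bar> < d"
    show "cmod (duhamel f t x - duhamel f t' x') < e"
    proof (cases "t \<le> t'")
      case True
      then show ?thesis using * by (intro main) auto
    next
      case False
      then have "cmod (duhamel f t' x' - duhamel f t x) < e" using * by (intro main) auto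
      then show ?thesis by (simp add: norm_minus_commute)
    qed
  qed
qed

end

text \<open>By linearity the difference is the Duhamel term of the forcing \<open>f - g\<close>, so
  only its own constant \<open>L\<close> enters, not \<open>K\<close> and \<open>K'\<close>.\<close>

lemma duhamel_diff_bound:
  assumes "forcing f K" "forcing g K'" and C2: "\<And>\<tau>. C2_le L (\<lambda>x. f \<tau> x - g \<tau> x)" and t: "0 \<le> t" "t \<le> 1"
  shows "cmod (duhamel f t x - duhamel g t x) \<le> 106 * L * t"
proof -
  interpret f: forcing f K by fact
  interpret g: forcing g K' by fact
  interpret forcing "\<lambda>\<tau> x. f \<tau> x - g \<tau> x" L
    by unfold_locales (use f.joint g.joint C2 in \<open>auto simp: case_prod_unfold intro!: continuous_intros\<close>)
  have "duhamel f t x - duhamel g t x = integral {0..t} (\<lambda>\<tau>. schr (t - \<tau>) (f \<tau>) x - schr (t - \<tau>) (g \<tau>) x)"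
    using t by (simp add: f.duhamel_eq g.duhamel_eq Henstock_Kurzweil_Integration.integral_diff
        integrable_continuous_real f.continuous_on_schr g.continuous_on_schr)
  also have "\<dots> = integral {0..t} (\<lambda>\<tau>. schr (t - \<tau>) (\<lambda>x. f \<tau> x - g \<tau> x) x)"
    by (intro Henstock_Kurzweil_Integration.integral_cong)
      (use t in \<open>simp add: schr_diff[OF f.C2 g.C2 C2]\<close>)
  also have "\<dots> = duhamel (\<lambda>\<tau> x. f \<tau> x - g \<tau> x) t x" using t by (simp add: duhamel_eq)
  finally show ?thesis using duhamel_bound[OF t] by simp
qed

section \<open>The contraction and its fixed point\<close>

definition picard :: "(real \<Rightarrow> real) \<Rightarrow> (real \<Rightarrow> complex) \<Rightarrow> (real \<Rightarrow> real \<Rightarrow> complex) \<Rightarrow> real \<Rightarrow> real \<Rightarrow> complex" where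
  "picard \<phi> u0 v t x = schr t u0 x - \<i> * duhamel (\<lambda>\<tau>. nonlin \<phi> (v \<tau>)) t x"

context decaying_kernel
begin

lemma forcing_nonlin:
  fixes v :: "real \<Rightarrow> real \<Rightarrow> complex"
  assumes c: "continuous_on UNIV (\<lambda>(t, x). v t x)" and R: "\<And>t x. cmod (v t x) \<le> R"
  shows "forcing (\<lambda>\<tau>. nonlin (D 0) (v \<tau>)) (4 * C * (4 * C * R) ^ 3)"
proof
  have cv: "continuous_on UNIV (v t)" for t
    by (rule continuous_on_compose2[OF c, of UNIV "\<lambda>x. (t, x)", simplified]) (intro continuous_intros)
  show "C2_le (4 * C * (4 * C * R) ^ 3) (nonlin (D 0) (v \<tau>))" for \<tau>
    by (rule nonlin_C2_le[OF cv R])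
qed (rule nonlin_continuous_param[OF assms])

lemma picard_bound:
  fixes v :: "real \<Rightarrow> real \<Rightarrow> complex"
  assumes u0: "C2_le K u0" and v: "continuous_on UNIV (\<lambda>(t, x). v t x)" "\<And>t x. cmod (v t x) \<le> R"
    and t: "0 \<le> t" "t \<le> 1"
  shows "cmod (picard (D 0) u0 v t x) \<le> 106 * K + 106 * (4 * C * (4 * C * R) ^ 3) * t"
  unfolding picard_def
  by (intro norm_triangle_le_diff add_mono schr_bound[OF u0 t])
    (simp only: norm_mult norm_ii mult_1 forcing.duhamel_bound[OF forcing_nonlin[OF v] t])

lemma picard_equicontinuous:
  fixes v :: "real \<Rightarrow> real \<Rightarrow> complex"
  assumes u0: "C2_le K u0" and v: "continuous_on UNIV (\<lambda>(t, x). v t x)" "\<And>t x. cmod (v t x) \<le> R"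
    and e: "0 < e"
  obtains d where "0 < d" "\<And>t t' x x'. t \<in> {0..1} \<Longrightarrow> t' \<in> {0..1} \<Longrightarrow> \<bar>t - t'\<bar> < d \<Longrightarrow> \<bar>x - x'\<bar> < d \<Longrightarrow>
      cmod (picard (D 0) u0 v t x - picard (D 0) u0 v t' x') < e"
proof -
  let ?f = "\<lambda>\<tau>. nonlin (D 0) (v \<tau>)"
  have e2: "0 < e / 2" using e by simp
  obtain d1 where d1: "0 < d1"
    "\<And>f t t' x x'. C2_le K f \<Longrightarrow> t \<in> {0..1} \<Longrightarrow> t' \<in> {0..1} \<Longrightarrow> \<bar>t - t'\<bar> < d1 \<Longrightarrow> \<bar>x - x'\<bar> < d1 \<Longrightarrow>
      cmod (schr t f x - schr t' f x') < e / 2"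
    by (rule schr_equicontinuous[OF e2, where K=K]) blast
  obtain d2 where d2: "0 < d2" "\<And>t t' x x'. t \<in> {0..1} \<Longrightarrow> t' \<in> {0..1} \<Longrightarrow> \<bar>t - t'\<bar> < d2 \<Longrightarrow> \<bar>x - x'\<bar> < d2 \<Longrightarrow>
      cmod (duhamel ?f t x - duhamel ?f t' x') < e / 2"
    by (rule forcing.duhamel_equicontinuous[OF forcing_nonlin[OF v] e2]) blast
  show ?thesis
  proof (rule that[of "min d1 d2"])
    fix t t' x x' :: real
    assume *: "t \<in> {0..1}" "t' \<in> {0..1}" "\<bar>t - t'\<bar> < min d1 d2" "\<bar>x - x'\<bar> < min d1 d2"
    have "picard (D 0) u0 v t x - picard (D 0) u0 v t' x'
        = (schr t u0 x - schr t' u0 x') - \<i> * (duhamel ?f t x - duhamel ?f t' x')"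
      by (simp add: picard_def algebra_simps)
    also have "cmod \<dots> \<le> cmod (schr t u0 x - schr t' u0 x') + cmod (\<i> * (duhamel ?f t x - duhamel ?f t' x'))"
      by (rule norm_triangle_ineq4)
    also have "\<dots> < e / 2 + e / 2"
      unfolding norm_mult norm_ii mult_1 by (intro add_strict_mono d1(2)[OF u0] d2(2)) (use * in auto)
    finally show "cmod (picard (D 0) u0 v t x - picard (D 0) u0 v t' x') < e" by simp
  qed (use d1 d2 in auto)
qed

lemma picard_diff:
  fixes v w :: "real \<Rightarrow> real \<Rightarrow> complex"
  assumes v: "continuous_on UNIV (\<lambda>(t, x). v t x)" "\<And>t x. cmod (v t x) \<le> R"
    and w: "continuous_on UNIV (\<lambda>(t, x). w t x)" "\<And>t x. cmod (w t x) \<le> R"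
    and d: "\<And>t x. cmod (v t x - w t x) \<le> d" and t: "0 \<le> t" "t \<le> 1"
  shows "cmod (picard (D 0) u0 v t x - picard (D 0) u0 w t x)
    \<le> 106 * (4 * C * (3 * (4 * C * R)\<^sup>2 * (4 * C * d))) * t"
proof -
  have cv: "continuous_on UNIV (v t)" and cw: "continuous_on UNIV (w t)" for t
    by (rule continuous_on_compose2[OF v(1), of UNIV "\<lambda>x. (t, x)", simplified], intro continuous_intros)
      (rule continuous_on_compose2[OF w(1), of UNIV "\<lambda>x. (t, x)", simplified], intro continuous_intros)
  have "picard (D 0) u0 v t x - picard (D 0) u0 w t x
      = - \<i> * (duhamel (\<lambda>\<tau>. nonlin (D 0) (v \<tau>)) t x - duhamel (\<lambda>\<tau>. nonlin (D 0) (w \<tau>)) t x)"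
    by (simp add: picard_def algebra_simps)
  then have "cmod (picard (D 0) u0 v t x - picard (D 0) u0 w t x)
      = cmod (duhamel (\<lambda>\<tau>. nonlin (D 0) (v \<tau>)) t x - duhamel (\<lambda>\<tau>. nonlin (D 0) (w \<tau>)) t x)"
    by (simp add: norm_mult)
  also have "\<dots> \<le> 106 * (4 * C * (3 * (4 * C * R)\<^sup>2 * (4 * C * d))) * t"
    by (rule duhamel_diff_bound[OF forcing_nonlin[OF v] forcing_nonlin[OF w] _ t])
      (rule nonlin_diff_C2_le[OF cv v(2) cw w(2) d])
  finally show ?thesis .
qed

lemma duhamel_fixed_point:
  assumes u0: "C2_le K u0" and T: "0 \<le> T" "T \<le> 1" and R: "0 \<le> R"
    and stay: "106 * K + 106 * (4 * C * (4 * C * R) ^ 3) * T \<le> R"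
    and contract: "106 * (4 * C * (3 * (4 * C * R)\<^sup>2 * (4 * C))) * T \<le> 1 / 2"
  obtains u where "duhamel_solution (D 0) u0 T u" "bounded ((\<lambda>(t, x). u t x) ` ({0..T} \<times> UNIV))"
    "uniformly_continuous_on ({0..T} \<times> UNIV) (\<lambda>(t, x). u t x)"
proof -
  have K: "0 \<le> K" using C2_le_nonneg[OF u0] .
  \<comment> \<open>Clamping time to \<open>[0, T]\<close> extends every iterate to the whole plane,
    where bounded continuous functions form a complete space; on \<open>[0, T]\<close> nothing
    changes.\<close>
  define c where "c t = max 0 (min T t)" for t
  have c: "0 \<le> c t" "c t \<le> T" "c t \<le> 1" "\<bar>c t - c t'\<bar> \<le> \<bar>t - t'\<bar>" for t t'
    using T by (auto simp: c_def)
  have c_id: "c t = t" if "t \<in> {0..T}" for t using that by (auto simp: c_def)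
  define P where "P v = (\<lambda>(t, x). picard (D 0) u0 (\<lambda>t x. apply_bcontfun v (t, x)) (c t) x)" for v :: "(real \<times> real) \<Rightarrow>\<^sub>C complex"
  have joint: "continuous_on UNIV (\<lambda>(t, x). apply_bcontfun v (t, x))" for v :: "(real \<times> real) \<Rightarrow>\<^sub>C complex"
    by (simp add: case_prod_unfold)
  have nb: "cmod (apply_bcontfun v (t, x)) \<le> norm v" for v :: "(real \<times> real) \<Rightarrow>\<^sub>C complex" and t x
    by (rule norm_bounded)
  \<comment> \<open>This serves twice: images are continuous, and the fixed point, being its own
    image, is uniformly continuous.\<close>
  have uc: "uniformly_continuous_on UNIV (P v)" for v
    unfolding uniformly_continuous_on_def
  proof (intro allI impI)
    fix e :: real assume e: "0 < e"
    obtain d where d: "0 < d" "\<And>t t' x x'. t \<in> {0..1} \<Longrightarrow> t' \<in> {0..1} \<Longrightarrow> \<bar>t - t'\<bar> < d \<Longrightarrow> \<bar>x - x'\<bar> < d \<Longrightarrow>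
      cmod (picard (D 0) u0 (\<lambda>t x. apply_bcontfun v (t, x)) t x - picard (D 0) u0 (\<lambda>t x. apply_bcontfun v (t, x)) t' x') < e"
      by (rule picard_equicontinuous[OF u0 joint nb e]) blast
    have "dist (P v q) (P v p) < e" if "dist q p < d" for p q
    proof -
      have "\<bar>fst q - fst p\<bar> < d" "\<bar>snd q - snd p\<bar> < d"
        using that dist_fst_le[of q p] dist_snd_le[of q p] by (auto simp: dist_real_def)
      then show ?thesis unfolding P_def case_prod_unfold dist_norm
        using c by (intro d(2)) (auto intro: order.strict_trans1[OF c(4)])
    qed
    then show "\<exists>d>0. \<forall>x\<in>UNIV. \<forall>x'\<in>UNIV. dist x' x < d \<longrightarrow> dist (P v x') (P v x) < e"
      using d(1) by blast
  qed
  have Pb: "cmod (P v p) \<le> R" if "norm v \<le> R" for v p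
  proof -
    have "cmod (P v p) \<le> 106 * K + 106 * (4 * C * (4 * C * R) ^ 3) * c (fst p)"
      unfolding P_def case_prod_unfold
      by (rule picard_bound[OF u0 joint order_trans[OF nb that] c(1,3)])
    also have "\<dots> \<le> 106 * K + 106 * (4 * C * (4 * C * R) ^ 3) * T"
      using C_nonneg order_trans[OF norm_ge_zero that]
      by (intro add_mono mult_left_mono c) auto
    finally show ?thesis using stay by linarith
  qed
  \<comment> \<open>\<open>\<Phi>\<close> is defined on the whole space, so boundedness is shown for
    arbitrary \<open>v\<close>, with a constant depending on \<open>norm v\<close>.\<close>
  have Pbc: "P v \<in> bcontfun" for v
  proof (rule bcontfun_normI)
    show "continuous_on UNIV (P v)" by (rule uniformly_continuous_imp_continuous[OF uc])
    show "cmod (P v p) \<le> 106 * K + 106 * (4 * C * (4 * C * norm v) ^ 3) * 1" for p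
      unfolding P_def case_prod_unfold
      using C_nonneg c by (intro order_trans[OF picard_bound[OF u0 joint nb]] add_mono mult_left_mono) auto
  qed
  define \<Phi> where "\<Phi> v = Bcontfun (P v)" for v
  have \<Phi>: "apply_bcontfun (\<Phi> v) = P v" for v
    unfolding \<Phi>_def by (rule Bcontfun_inverse[OF Pbc])
  have "\<exists>!v\<in>cball 0 R. \<Phi> v = v"
  proof (rule Banach_fix[where c="1/2"])
    show "complete (cball (0 :: (real \<times> real) \<Rightarrow>\<^sub>C complex) R)"
      by (simp add: complete_eq_closed)
    show "cball (0 :: (real \<times> real) \<Rightarrow>\<^sub>C complex) R \<noteq> {}" using R by simp
    show "\<Phi> ` cball 0 R \<subseteq> cball 0 R"
      using Pb by (auto intro!: norm_bound simp: \<Phi>)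
    fix v w :: "(real \<times> real) \<Rightarrow>\<^sub>C complex"
    assume vw: "v \<in> cball 0 R" "w \<in> cball 0 R"
    have d: "cmod (apply_bcontfun v (t, x) - apply_bcontfun w (t, x)) \<le> dist v w" for t x
      using dist_bounded[where f=v and g=w and x="(t, x)"] by (simp add: dist_norm)
    show "dist (\<Phi> v) (\<Phi> w) \<le> 1 / 2 * dist v w"
    proof (rule dist_bound)
      fix p
      have "dist (P v p) (P w p) \<le> 106 * (4 * C * (3 * (4 * C * R)\<^sup>2 * (4 * C * dist v w))) * c (fst p)"
        unfolding P_def case_prod_unfold dist_norm
        by (rule picard_diff[OF joint order_trans[OF nb] joint order_trans[OF nb] d[unfolded dist_norm] c(1,3)])
          (use vw in auto)
      also have "\<dots> \<le> 106 * (4 * C * (3 * (4 * C * R)\<^sup>2 * (4 * C * dist v w))) * T"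
        using C_nonneg by (intro mult_left_mono c) auto
      also have "\<dots> = (106 * (4 * C * (3 * (4 * C * R)\<^sup>2 * (4 * C))) * T) * dist v w" by (simp add: algebra_simps)
      also have "\<dots> \<le> 1 / 2 * dist v w" using contract by (intro mult_right_mono) auto
      finally show "dist (apply_bcontfun (\<Phi> v) p) (apply_bcontfun (\<Phi> w) p) \<le> 1 / 2 * dist v w" by (simp add: \<Phi>)
    qed
  qed auto
  then obtain v where v: "norm v \<le> R" "\<Phi> v = v" by auto
  define u where "u = (\<lambda>t x. apply_bcontfun v (t, x))"
  have fp: "apply_bcontfun v = P v" using \<Phi>[of v] v(2) by simp
  have u_eq: "u t x = picard (D 0) u0 u (c t) x" for t x
    unfolding u_def by (subst fp) (simp add: P_def)
  have case_u: "(\<lambda>(t, x). u t x) = P v" unfolding u_def using fp by auto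
  interpret forcing "\<lambda>\<tau>. nonlin (D 0) (u \<tau>)" "4 * C * (4 * C * norm v) ^ 3"
    unfolding u_def by (rule forcing_nonlin[OF joint nb])
  show ?thesis
  proof (rule that[of u])
    show "duhamel_solution (D 0) u0 T u"
      unfolding duhamel_solution_def
    proof (intro ballI allI conjI)
      fix t x assume t: "t \<in> {0..T}"
      then have t1: "0 \<le> t" "t \<le> 1" using T by auto
      show "schr_converges t u0 x" by (rule schr_converges[OF u0 t1])
      show "schr_converges (t - \<tau>) (nonlin (D 0) (u \<tau>)) x" if "\<tau> \<in> {0..t}" for \<tau>
        by (rule schr_converges[OF C2]) (use that t1 in auto)
      show "set_integrable lborel {0..t} (\<lambda>\<tau>. schr (t - \<tau>) (nonlin (D 0) (u \<tau>)) x)"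
        by (rule set_integrable_schr[OF t1(2)])
      show "u t x = schr t u0 x - \<i> * (LINT \<tau>:{0..t}|lborel. schr (t - \<tau>) (nonlin (D 0) (u \<tau>)) x)"
        using u_eq[of t x] c_id[OF t] by (simp add: picard_def duhamel_def)
    qed
    show "bounded ((\<lambda>(t, x). u t x) ` ({0..T} \<times> UNIV))"
      unfolding case_u bounded_iff using Pb[OF v(1)] by blast
    show "uniformly_continuous_on ({0..T} \<times> UNIV) (\<lambda>(t, x). u t x)"
      unfolding case_u using uc[of v] unfolding uniformly_continuous_on_def by (meson UNIV_I)
  qed
qed

end

section \<open>Passage from the hypotheses, and the choice of the time\<close>

lemma schwartz_decaying_kernel:
  assumes "schwartz \<phi>"
  obtains C where "decaying_kernel (\<lambda>n. (deriv ^^ n) \<phi>) C"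
proof -
  have "\<exists>C. \<forall>y. \<bar>(deriv ^^ n) \<phi> y\<bar> \<le> C / (1 + y\<^sup>2)" for n
  proof -
    \<comment> \<open>The seminorms with weights 1 and \<open>y\<^sup>2\<close> add up to the weight
      \<open>1 + y\<^sup>2\<close>.\<close>
    obtain A B where AB: "\<And>y. \<bar>y\<bar> ^ 0 * \<bar>(deriv ^^ n) \<phi> y\<bar> \<le> A" "\<And>y. \<bar>y\<bar> ^ 2 * \<bar>(deriv ^^ n) \<phi> y\<bar> \<le> B"
      using assms unfolding schwartz_def by metis
    have "\<bar>(deriv ^^ n) \<phi> y\<bar> \<le> (A + B) / (1 + y\<^sup>2)" for y
      using AB(1)[of y] AB(2)[of y] by (simp add: le_divide_eq add_pos_nonneg algebra_simps)
    then show ?thesis by blast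
  qed
  then obtain c where c: "\<And>n y. \<bar>(deriv ^^ n) \<phi> y\<bar> \<le> c n / (1 + y\<^sup>2)" by metis
  have "decaying_kernel (\<lambda>n. (deriv ^^ n) \<phi>) (\<Sum>n\<le>4. \<bar>c n\<bar>)"
  proof
    fix n y
    have "(deriv ^^ n) \<phi> differentiable (at y)" using assms by (auto simp: schwartz_def)
    then show "((deriv ^^ n) \<phi> has_real_derivative (deriv ^^ Suc n) \<phi> y) (at y)"
      by (simp add: DERIV_deriv_iff_real_differentiable)
    assume "n \<le> (4 :: nat)"
    then have "\<bar>c n\<bar> \<le> (\<Sum>n\<le>4. \<bar>c n\<bar>)"
      by (intro member_le_sum) auto
    then have "c n \<le> (\<Sum>n\<le>4. \<bar>c n\<bar>)" by linarith
    then show "\<bar>(deriv ^^ n) \<phi> y\<bar> \<le> (\<Sum>n\<le>4. \<bar>c n\<bar>) / (1 + y\<^sup>2)"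
      by (intro order_trans[OF c] divide_right_mono) auto
  qed
  then show ?thesis by (rule that)
qed

text \<open>Landau's interpolation: a Taylor step of length 1 bounds \<open>u1\<close> by
  \<open>u0\<close> at two points and \<open>u2\<close>. Hence the existence time can depend on the
  two sup norms alone.\<close>

lemma C2_bdd_imp_C2_le:
  assumes "C2_bdd u0 u1 u2"
  shows "C2_le (2 * \<bar>sup_norm u0\<bar> + \<bar>sup_norm u2\<bar>) u0"
proof -
  note u = assms[unfolded C2_bdd_def]
  have sup: "cmod (f x) \<le> \<bar>sup_norm f\<bar>" if "bounded (range f)" for f :: "real \<Rightarrow> complex" and x
  proof -
    have "bdd_above (range (\<lambda>x. cmod (f x)))"
      using that by (auto simp: bounded_iff bdd_above_def)
    then have "cmod (f x) \<le> sup_norm f" unfolding sup_norm_def by (rule cSUP_upper[OF UNIV_I])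
    then show ?thesis by simp
  qed
  have b: "cmod (u0 x) \<le> \<bar>sup_norm u0\<bar>" "cmod (u2 x) \<le> \<bar>sup_norm u2\<bar>" for x
    using u by (auto intro: sup)
  have "cmod (u1 x) \<le> 2 * \<bar>sup_norm u0\<bar> + \<bar>sup_norm u2\<bar>" for x
  proof -
    have "cmod (u0 (x + 1) - u0 x - 1 *\<^sub>R u1 x) \<le> \<bar>sup_norm u2\<bar> * 1\<^sup>2"
      by (rule taylor_quadratic) (use u b in auto)
    then have "cmod (u1 x) \<le> cmod (u0 (x + 1)) + cmod (u0 x) + \<bar>sup_norm u2\<bar>"
      using norm_triangle_ineq4[of "u0 (x + 1) - u0 x" "u0 (x + 1) - u0 x - u1 x"] norm_triangle_ineq4[of "u0 (x + 1)" "u0 x"]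
      by simp
    then show ?thesis using b(1)[of x] b(1)[of "x + 1"] by linarith
  qed
  moreover have "cmod (u0 x) \<le> 2 * \<bar>sup_norm u0\<bar> + \<bar>sup_norm u2\<bar>" "cmod (u2 x) \<le> 2 * \<bar>sup_norm u0\<bar> + \<bar>sup_norm u2\<bar>" for x
    using b[of x] by linarith+
  ultimately show ?thesis unfolding C2_le_def using u by blast
qed

theorem theorem1:
  fixes \<phi> :: "real \<Rightarrow> real"
  assumes "schwartz \<phi>" and "even_fun \<phi>"
  shows "\<exists>Tf :: real \<Rightarrow> real \<Rightarrow> real. (\<forall>a b. Tf a b > 0) \<and>
    (\<forall>u0 u1 u2. C2_bdd u0 u1 u2 \<longrightarrow>
      (\<exists>u :: real \<Rightarrow> real \<Rightarrow> complex.
         let T = Tf (sup_norm u0) (sup_norm u2) in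
         duhamel_solution \<phi> u0 T u \<and>
         bounded ((\<lambda>(t, x). u t x) ` ({0..T} \<times> UNIV)) \<and>
         uniformly_continuous_on ({0..T} \<times> UNIV) (\<lambda>(t, x). u t x)))"
proof -
  obtain C where "decaying_kernel (\<lambda>n. (deriv ^^ n) \<phi>) C"
    using schwartz_decaying_kernel[OF assms(1)] .
  then interpret decaying_kernel "\<lambda>n. (deriv ^^ n) \<phi>" C .
  define K where "K a b = 2 * \<bar>a\<bar> + \<bar>b\<bar>" for a b :: real
  \<comment> \<open>The linear part takes \<open>106 * K\<close>; the extra 1 leaves room for the
    nonlinear term.\<close>
  define R where "R a b = 106 * K a b + 1" for a b
  define p where "p a b = 106 * (4 * C * (4 * C * R a b) ^ 3)" for a b
  define q where "q a b = 106 * (4 * C * (3 * (4 * C * R a b)\<^sup>2 * (4 * C)))" for a b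
  \<comment> \<open>The three summands of the denominator ensure, in turn, \<open>T \<le> 1\<close>,
    invariance of the ball, and contraction by one half. Absolute values in \<open>K\<close> keep
    this positive for all real arguments.\<close>
  define Tf where "Tf a b = 1 / (1 + p a b + 2 * q a b)" for a b
  have R: "0 \<le> R a b" for a b by (simp add: R_def K_def)
  have p: "0 \<le> p a b" for a b using C_nonneg R by (simp add: p_def)
  have q: "0 \<le> q a b" for a b using C_nonneg by (simp add: q_def)
  have Tf: "0 < Tf a b" "Tf a b \<le> 1" "p a b * Tf a b \<le> 1" "q a b * Tf a b \<le> 1 / 2" for a b
    using p[of a b] q[of a b] by (auto simp: Tf_def add_pos_nonneg divide_le_eq)
  show ?thesis
  proof (intro exI[of _ Tf] conjI allI impI)
    show "0 < Tf a b" for a b by (rule Tf)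
    fix u0 u1 u2 assume u: "C2_bdd u0 u1 u2"
    let ?a = "sup_norm u0" and ?b = "sup_norm u2"
    have C2: "C2_le (K ?a ?b) u0" using C2_bdd_imp_C2_le[OF u] by (simp add: K_def)
    obtain u where "duhamel_solution ((deriv ^^ 0) \<phi>) u0 (Tf ?a ?b) u"
      "bounded ((\<lambda>(t, x). u t x) ` ({0..Tf ?a ?b} \<times> UNIV))"
      "uniformly_continuous_on ({0..Tf ?a ?b} \<times> UNIV) (\<lambda>(t, x). u t x)"
    proof (rule duhamel_fixed_point[OF C2, of "Tf ?a ?b" "R ?a ?b"])
      show "106 * K ?a ?b + 106 * (4 * C * (4 * C * R ?a ?b) ^ 3) * Tf ?a ?b \<le> R ?a ?b"
        using Tf(3)[of ?a ?b] by (simp add: p_def R_def)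
      show "106 * (4 * C * (3 * (4 * C * R ?a ?b)\<^sup>2 * (4 * C))) * Tf ?a ?b \<le> 1 / 2"
        using Tf(4)[of ?a ?b] by (simp add: q_def)
    qed (use Tf(1,2)[of ?a ?b] R in auto)
    then show "\<exists>u :: real \<Rightarrow> real \<Rightarrow> complex.
         let T = Tf ?a ?b in duhamel_solution \<phi> u0 T u \<and>
         bounded ((\<lambda>(t, x). u t x) ` ({0..T} \<times> UNIV)) \<and>
         uniformly_continuous_on ({0..T} \<times> UNIV) (\<lambda>(t, x). u t x)"
      by (auto simp: Let_def)
  qed
qed

end
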